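(* Let $d>0$, $\delta>0$, and let $Z$ have the non-standardised Student's $t$ density $$p(x)=\frac{\Gamma(\frac{d+1}2)}{\sqrt{\pi\delta^2}\,\Gamma(\frac d2)}\Big(1+\frac{x^2}{\delta^2}\Big)^{-\frac12(d+1)},\qquad x\in\mathbb{R}.$$ Let $n\ge0$ be an integer with $d-2n>0$, let $h\in C_b^n(\mathbb{R})$, put $\tilde h(x)=h(x)-\mathbb{E}h(Z)$, and let $$f(x)=(\delta^2+x^2)^{(d-1)/2}\int_{-\infty}^x(\delta^2+t^2)^{-(d+1)/2}\tilde h(t)\,dt,$$ which solves the Stein equation $(\delta^2+x^2)f'(x)-(d-1)xf(x)=\tilde h(x)$. Then $$\|f^{(n)}\|\le\sum_{j=0}^n\Big(\frac{\sqrt\pi}{2\delta}\Big)^{n+1-j}\frac{n!}{j!}\,(d-n)_{n-j}\,A_j\,\|\tilde h^{(j)}\|,\qquad A_j=\prod_{i=j}^n\frac{\Gamma(\frac d2-i)}{\Gamma(\frac{d+1}2-i)}.$$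
   Context: $\|\cdot\|$ denotes the supremum norm on $\mathbb{R}$. $h\in C_b^n(\mathbb{R})$ means that $h^{(n-1)}$ exists and is absolutely continuous, with derivatives of $h$ up to order $n$ bounded ($h$ itself included); for $n=0$, $h$ is bounded. $(x)_n=x(x+1)\cdots(x+n-1)$ is the Pochhammer symbol, with $(x)_0=1$. $\tilde h^{(0)}=\tilde h$ and $\tilde h^{(j)}=h^{(j)}$ for $j\ge1$. *)

theory Defs
  imports "HOL-Probability.Probability"
begin

text \<open>
  The set of points at which the \<open>j\<close>-th derivative of \<open>g\<close> exists: the previous derivative has to
  exist on a neighbourhood of the point and to be differentiable at the point.  The value there is
  \<open>(deriv ^^ j) g\<close>; elsewhere \<open>deriv\<close> returns an unspecified number, so suprema of derivatives must be
  restricted to this set.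
\<close>

primrec deriv_dom :: "nat \<Rightarrow> (real \<Rightarrow> real) \<Rightarrow> real set" where
  "deriv_dom 0 g = UNIV"
| "deriv_dom (Suc j) g =
     {x. (\<forall>\<^sub>F y in nhds x. y \<in> deriv_dom j g) \<and> (deriv ^^ j) g differentiable (at x)}"

text \<open>
  A genuine supremum norm only if the set is nonempty and the values are bounded (\<open>Sup\<close> on the reals
  is unspecified otherwise), so boundedness is always stated separately.
\<close>

definition deriv_norm :: "nat \<Rightarrow> (real \<Rightarrow> real) \<Rightarrow> real" where
  "deriv_norm j g = (SUP x\<in>deriv_dom j g. \<bar>(deriv ^^ j) g x\<bar>)"

definition abs_cont_on :: "real \<Rightarrow> real \<Rightarrow> (real \<Rightarrow> real) \<Rightarrow> bool" where
  "abs_cont_on a b g \<longleftrightarrow>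
     (\<forall>\<epsilon>>0. \<exists>\<eta>>0. \<forall>I :: (real \<times> real) set.
        finite I \<longrightarrow>
        (\<forall>(u, v)\<in>I. a \<le> u \<and> u < v \<and> v \<le> b) \<longrightarrow>
        pairwise (\<lambda>(u, v) (u', v'). disjnt {u<..<v} {u'<..<v'}) I \<longrightarrow>
        (\<Sum>(u, v)\<in>I. v - u) < \<eta> \<longrightarrow>
        (\<Sum>(u, v)\<in>I. \<bar>g v - g u\<bar>) < \<epsilon>)"

text \<open>
  The class \<open>C\<^sub>b\<^sup>n\<close>.  Absolute continuity on the line is required on every compact interval; together
  with boundedness of the \<open>n\<close>-th derivative this is equivalent to the version on the whole line (both
  amount to Lipschitz continuity).  The \<open>n\<close>-th derivative exists only almost everywhere; this follows
  from absolute continuity and is recorded because its boundedness refers to it.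
  For \<open>n = 0\<close> the predicate says just that \<open>h\<close> is bounded.
\<close>

definition Cb :: "nat \<Rightarrow> (real \<Rightarrow> real) \<Rightarrow> bool" where
  "Cb n h \<longleftrightarrow>
     (n \<ge> 1 \<longrightarrow> deriv_dom (n - 1) h = UNIV \<and> (\<forall>a b. abs_cont_on a b ((deriv ^^ (n - 1)) h))) \<and>
     (AE x in lborel. x \<in> deriv_dom n h) \<and>
     (\<forall>j\<le>n. bounded ((deriv ^^ j) h ` deriv_dom j h))"

definition student_t_density :: "real \<Rightarrow> real \<Rightarrow> real \<Rightarrow> real" where
  "student_t_density d \<delta> x =
     Gamma ((d + 1) / 2) / (sqrt (pi * \<delta>\<^sup>2) * Gamma (d / 2)) *
     (1 + x\<^sup>2 / \<delta>\<^sup>2) powr (- (1 / 2) * (d + 1))"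

definition stein_solution :: "real \<Rightarrow> real \<Rightarrow> (real \<Rightarrow> real) \<Rightarrow> real \<Rightarrow> real" where
  "stein_solution d \<delta> g x =
     (\<delta>\<^sup>2 + x\<^sup>2) powr ((d - 1) / 2) *
     (LINT t:{..x}|lborel. (\<delta>\<^sup>2 + t\<^sup>2) powr (- (d + 1) / 2) * g t)"

definition solves_stein_at :: "real \<Rightarrow> real \<Rightarrow> (real \<Rightarrow> real) \<Rightarrow> (real \<Rightarrow> real) \<Rightarrow> real \<Rightarrow> bool" where
  "solves_stein_at d \<delta> g f x \<longleftrightarrow>
     f differentiable (at x) \<and> (\<delta>\<^sup>2 + x\<^sup>2) * deriv f x - (d - 1) * x * f x = g x"

end

theory Submission
  imports Defs "HOL-Real_Asymp.Real_Asymp"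
begin

text \<open>
  Write \<open>w = \<delta>\<^sup>2 + x\<^sup>2\<close>. Differentiating the Stein equation \<open>k\<close> times gives
  \<open>w f\<^bsup>(k+1)\<^esup> - (d - 2k - 1) x f\<^bsup>(k)\<^esup> = h\<^bsup>(k)\<^esup> + k (d - k) f\<^bsup>(k-1)\<^esup>\<close>,
  so \<open>f\<^bsup>(k)\<^esup>\<close> solves the Stein equation with \<open>d - 2k\<close> in place of \<open>d\<close> and a bounded right-hand side.
  If \<open>w \<phi>' - (d - 1) x \<phi> = r\<close> with \<open>\<bar>r\<bar> \<le> R\<close> almost everywhere and \<open>\<psi> = w\<^bsup>-(d-1)/2\<^esup> \<phi>\<close> vanishes at
  both infinities, then \<open>\<psi>' = w\<^bsup>-(d+1)/2\<^esup> r\<close>, so \<open>\<psi>\<close> is dominated by \<open>R\<close> times the tail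
  integral \<open>W\<close> of \<open>w\<^bsup>-(d+1)/2\<^esup>\<close>; and \<open>w\<^bsup>(d-1)/2\<^esup> W\<close> is largest at \<open>0\<close> on the negative half-line,
  which produces the Gamma quotient. The comparison uses only that \<open>\<phi>\<close> is locally Lipschitz and
  differentiable almost everywhere. The decay of \<open>f\<^bsup>(k)\<^esup>\<close> needed to iterate comes from the equation
  one level below: \<open>x f\<^bsup>(k-1)\<^esup>\<close> is bounded, hence so is \<open>w f\<^bsup>(k)\<^esup>\<close>.
\<close>

section \<open>Absolute continuity and monotonicity\<close>

text \<open>
  Cousin's lemma: tags off \<open>N\<close> are controlled by differentiability, while the intervals with a tag
  in \<open>N\<close> lie in an open set of small measure and are controlled by absolute continuity.
\<close>

lemma abs_cont_on_deriv_nonneg_imp_le: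
  fixes F :: "real \<Rightarrow> real"
  assumes ab: "a \<le> b" and ac: "abs_cont_on a b F" and N: "negligible N"
    and der: "\<And>x. x \<in> {a..b} - N \<Longrightarrow> \<exists>D\<ge>0. (F has_real_derivative D) (at x)"
  shows "F a \<le> F b"
proof (rule field_le_epsilon)
  fix e :: real assume e: "e > 0"
  \<comment> \<open>The budget \<open>e\<close> is halved: a loss of slope \<open>e1\<close> over
    the length \<open>b - a\<close> costs at most \<open>e / 2\<close>, and the intervals tagged in
    \<open>N\<close> cost less than the other half. The \<open>+ 1\<close> covers
    \<open>a = b\<close>.\<close>
  define e1 where "e1 = e / (2 * (b - a + 1))"
  have e1: "e1 > 0" "e1 * (b - a) \<le> e / 2"
    using e ab by (auto simp: e1_def field_simps)
  obtain \<eta> where \<eta>: "\<eta> > 0" and I: "\<And>I. finite I \<Longrightarrow> 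
        (\<forall>(u, v)\<in>I. a \<le> u \<and> u < v \<and> v \<le> b) \<Longrightarrow>
        pairwise (\<lambda>(u, v) (u', v'). disjnt {u<..<v} {u'<..<v'}) I \<Longrightarrow>
        (\<Sum>(u, v)\<in>I. v - u) < \<eta> \<Longrightarrow>
        (\<Sum>(u, v)\<in>I. \<bar>F v - F u\<bar>) < e / 2"
    using ac[unfolded abs_cont_on_def, rule_format, of "e/2"] e by force
  have Ns: "N \<in> null_sets lebesgue"
    using N by (simp add: negligible_iff_null_sets)
  \<comment> \<open>Outer regularity; since \<open>N\<close> is null, smallness of
    \<open>T - N\<close> is smallness of \<open>T\<close>.\<close>
  obtain T where T: "open T" "N \<subseteq> T" "T - N \<in> lmeasurable" "emeasure lebesgue (T - N) < ennreal \<eta>"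
    using sets_lebesgue_outer_open[of N \<eta>] Ns \<eta> by blast
  have Tl: "T \<in> sets lebesgue" using T(1) by auto
  have Tm: "emeasure lebesgue T < ennreal \<eta>"
    using emeasure_Diff_null_set[OF Ns Tl] T by auto
  have Tmm: "T \<in> lmeasurable"
    using Tm Tl by (intro fmeasurableI) (auto intro: order.strict_trans)
  have Tmu: "measure lebesgue T < \<eta>"
    using Tm \<eta> by (simp add: emeasure_eq_measure2[OF Tmm] ennreal_less_iff)
  have "\<exists>R>0. (x \<in> N \<longrightarrow> ball x R \<subseteq> T) \<and> (x \<in> {a..b} - N \<longrightarrow> 
      (\<forall>u v. u \<le> x \<and> x \<le> v \<and> u \<in> ball x R \<and> v \<in> ball x R \<longrightarrow> F v - F u \<ge> - e1 * (v - u)))" for x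
  proof (cases "x \<in> N")
    case True
    then obtain R where "R > 0" "ball x R \<subseteq> T"
      using T(1,2) by (meson openE subsetD)
    then show ?thesis using True by auto
  next
    case xN: False
    show ?thesis
    proof (cases "x \<in> {a..b}")
      case False then show ?thesis using xN by (auto intro: exI[of _ 1])
    next
      case True
      then obtain D where D: "D \<ge> 0" "(F has_real_derivative D) (at x)" using der xN by auto
      from D(2) have "(F has_derivative (*) D) (at x)" by (simp add: has_field_derivative_def)
      then obtain R where R: "R > 0" 
        "\<And>y. norm (y - x) < R \<Longrightarrow> norm (F y - F x - D * (y - x)) \<le> e1 * norm (y - x)"
        unfolding has_derivative_at_alt using e1(1) by blast
      \<comment> \<open>Straddling estimate: \<open>u\<close> and \<open>v\<close> lie on opposite
        sides of the tag, so the two linearisation errors add up to at most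
        \<open>e1 * (v - u)\<close>, while the linear part is nonnegative because
        \<open>D \<ge> 0\<close>.\<close>
      have "F v - F u \<ge> - e1 * (v - u)" if "u \<le> x" "x \<le> v" "u \<in> ball x R" "v \<in> ball x R" for u v
      proof -
        have "\<bar>F v - F x - D * (v - x)\<bar> \<le> e1 * (v - x)" "\<bar>F u - F x - D * (u - x)\<bar> \<le> e1 * (x - u)"
          using R(2)[of v] R(2)[of u] that by (auto simp: dist_real_def)
        moreover have "D * (v - x) \<ge> 0" "D * (x - u) \<ge> 0" using D that by auto
        ultimately show ?thesis by (auto simp: algebra_simps abs_le_iff)
      qed
      then show ?thesis using R(1) xN by blast
    qed
  qed
  then obtain R where R: "\<And>x. R x > 0" "\<And>x. x \<in> N \<Longrightarrow> ball x (R x) \<subseteq> T"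
     "\<And>x u v. x \<in> {a..b} - N \<Longrightarrow> u \<le> x \<Longrightarrow> x \<le> v \<Longrightarrow> u \<in> ball x (R x) \<Longrightarrow> v \<in> ball x (R x) \<Longrightarrow> F v - F u \<ge> - e1 * (v - u)"
    by metis
  obtain p where p: "p tagged_division_of {a..b}" "(\<lambda>x. ball x (R x)) fine p"
    using fine_division_exists_real[OF gauge_ball_dependent, of R a b] R(1) by blast
  have fp: "finite p" using p(1) by auto
  have K: "K = {Inf K..Sup K} \<and> Inf K \<le> x \<and> x \<le> Sup K \<and> a \<le> Inf K \<and> Sup K \<le> b \<and> K \<subseteq> ball x (R x)"
    if xK: "(x, K) \<in> p" for x K
  proof -
    obtain u v where uv: "K = cbox u v" using tagged_division_ofD(4)[OF p(1) xK] by blast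
    have "x \<in> K" "K \<subseteq> {a..b}" using tagged_division_ofD(2,3)[OF p(1) xK] by auto
    moreover have "K \<subseteq> ball x (R x)" using p(2) xK unfolding fine_def by blast
    ultimately show ?thesis using uv by (auto)
  qed
  \<comment> \<open>Degenerate intervals are left out: they contribute nothing, and nonempty
    interiors make \<open>m\<close>, which forgets the tags, injective.\<close>
  define p' where "p' = {(x,K) \<in> p. x \<in> N \<and> Inf K < Sup K}"
  have p'p: "p' \<subseteq> p" and fp': "finite p'" using fp unfolding p'_def by (auto intro: finite_subset)
  have disj: "{Inf K<..<Sup K} \<inter> {Inf L<..<Sup L} = {}" if "(x,K) \<in> p" "(y,L) \<in> p" "(x,K) \<noteq> (y,L)" for x K y L
  proof -
    have "interior K \<inter> interior L = {}" using tagged_division_ofD(5)[OF p(1) that] .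
    then show ?thesis using K[OF that(1)] K[OF that(2)] by (metis interior_atLeastAtMost_real)
  qed
  define m where "m = (\<lambda>(x::real,K::real set). (Inf K, Sup K))"
  have inj: "inj_on m p'"
  proof (rule inj_onI)
    fix z z' assume z: "z \<in> p'" "z' \<in> p'" and mm: "m z = m z'"
    obtain x K y L where zz: "z = (x,K)" "z' = (y,L)" by (metis surj_pair)
    have IS: "Inf K = Inf L" "Sup K = Sup L" using mm by (auto simp: m_def zz)
    have "{Inf K<..<Sup K} \<noteq> {}" using z by (auto simp: p'_def zz)
    then show "z = z'" using disj[of x K y L] z p'p IS by (auto simp: zz)
  qed
  have small: "(\<Sum>(x,K)\<in>p'. Sup K - Inf K) < \<eta>"
  proof -
    define A where "A = (\<lambda>(x::real,K::real set). {Inf K<..<Sup K})"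
    have "measure lebesgue (\<Union>z\<in>p'. A z) = (\<Sum>z\<in>p'. measure lebesgue (A z))"
    proof (rule measure_finite_Union[OF fp'])
      show "A ` p' \<subseteq> sets lebesgue" by (auto simp: A_def)
      show "disjoint_family_on A p'"
        unfolding disjoint_family_on_def
      proof (intro ballI impI)
        fix z z' assume *: "z \<in> p'" "z' \<in> p'" "z \<noteq> z'"
        obtain x K y L where "z = (x,K)" "z' = (y,L)" by (metis surj_pair)
        then show "A z \<inter> A z' = {}" using disj[of x K y L] p'p * by (auto simp: A_def)
      qed
      show "emeasure lebesgue (A i) \<noteq> \<infinity>" if "i \<in> p'" for i using that K p'p by (cases i) (auto simp: A_def p'_def)
    qed
    also have "(\<Sum>z\<in>p'. measure lebesgue (A z)) = (\<Sum>(x,K)\<in>p'. Sup K - Inf K)"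
      by (rule sum.cong) (auto simp: A_def p'_def)
    finally have "(\<Sum>(x,K)\<in>p'. Sup K - Inf K) = measure lebesgue (\<Union>z\<in>p'. A z)" by simp
    also have "\<dots> \<le> measure lebesgue T"
    proof (rule measure_mono_fmeasurable[OF _ _ Tmm])
      show "(\<Union>z\<in>p'. A z) \<in> sets lebesgue" using fp' by (auto simp: A_def)
      have "A z \<subseteq> T" if z: "z \<in> p'" for z
      proof -
        obtain x K' where xK: "z = (x,K')" by force
        have "(x,K') \<in> p" "x \<in> N" using z xK by (auto simp: p'_def)
        have "A z \<subseteq> {Inf K'..Sup K'}" by (auto simp: A_def xK)
        also have "\<dots> = K'" using K[OF \<open>(x,K') \<in> p\<close>] by blast
        also have "\<dots> \<subseteq> ball x (R x)" using K[OF \<open>(x,K') \<in> p\<close>] by blast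
        also have "\<dots> \<subseteq> T" using R(2) \<open>x \<in> N\<close> by blast
        finally show ?thesis .
      qed
      then show "(\<Union>z\<in>p'. A z) \<subseteq> T" by blast
    qed
    finally show ?thesis using Tmu by linarith
  qed
  have "(\<Sum>(u, v)\<in>m ` p'. \<bar>F v - F u\<bar>) < e / 2"
  proof (rule I)
    show "finite (m ` p')" using fp' by auto
    show "\<forall>(u, v)\<in>m ` p'. a \<le> u \<and> u < v \<and> v \<le> b" using K by (auto simp: m_def p'_def)
    show "pairwise (\<lambda>(u, v) (u', v'). disjnt {u<..<v} {u'<..<v'}) (m ` p')"
      unfolding pairwise_def disjnt_def using disj p'p by (fastforce simp: m_def)
    show "(\<Sum>(u, v)\<in>m ` p'. v - u) < \<eta>"
      using small by (subst sum.reindex[OF inj]) (auto simp: m_def case_prod_unfold)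
  qed
  then have S: "(\<Sum>(x,K)\<in>p'. \<bar>F (Sup K) - F (Inf K)\<bar>) < e / 2"
    by (subst (asm) sum.reindex[OF inj]) (auto simp: m_def case_prod_unfold)
  have "- (e1 * (b - a)) - (\<Sum>(x,K)\<in>p'. \<bar>F (Sup K) - F (Inf K)\<bar>) = 
     (\<Sum>(x,K)\<in>p. - e1 * (Sup K - Inf K)) - (\<Sum>(x,K)\<in>p. if (x,K) \<in> p' then \<bar>F (Sup K) - F (Inf K)\<bar> else 0)"
  proof -
    have "(\<Sum>(x,K)\<in>p. - e1 * (Sup K - Inf K)) = - e1 * (b - a)"
      using additive_tagged_division_1[OF ab p(1), of "\<lambda>x. x"] 
      by (simp only: sum_distrib_left[symmetric] case_prod_unfold)
    moreover have "(\<Sum>(x,K)\<in>p. if (x,K) \<in> p' then \<bar>F (Sup K) - F (Inf K)\<bar> else 0) = (\<Sum>(x,K)\<in>p'. \<bar>F (Sup K) - F (Inf K)\<bar>)"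
      using sum.inter_restrict[OF fp, of "\<lambda>z. \<bar>F (Sup (snd z)) - F (Inf (snd z))\<bar>" p'] p'p
      by (simp add: Int_absorb1 case_prod_unfold)
    ultimately show ?thesis by simp
  qed
  also have "\<dots> = (\<Sum>(x,K)\<in>p. - e1 * (Sup K - Inf K) - (if (x,K) \<in> p' then \<bar>F (Sup K) - F (Inf K)\<bar> else 0))"
    by (simp add: sum_subtractf case_prod_unfold)
  \<comment> \<open>Off \<open>N\<close> the slope bound applies; an interval with its tag in
    \<open>N\<close> is either degenerate or charged to \<open>p'\<close>.\<close>
  also have "\<dots> \<le> (\<Sum>(x,K)\<in>p. F (Sup K) - F (Inf K))"
  proof (rule sum_mono, safe)
    fix x K' assume xK: "(x,K') \<in> p"
    note k = K[OF xK]
    show "- e1 * (Sup K' - Inf K') - (if (x,K') \<in> p' then \<bar>F (Sup K') - F (Inf K')\<bar> else 0) \<le> F (Sup K') - F (Inf K')"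
    proof (cases "x \<in> N")
      case True
      have "e1 * (Sup K' - Inf K') \<ge> 0" using k e1 by simp
      moreover have "Sup K' = Inf K' \<or> (x,K') \<in> p'" using k True xK by (auto simp: p'_def)
      ultimately show ?thesis by auto
    next
      case False
      have "Inf K' \<in> K'" "Sup K' \<in> K'" using k by (metis atLeastAtMost_iff order.trans order_refl)+
      then have "F (Sup K') - F (Inf K') \<ge> - e1 * (Sup K' - Inf K')"
        using k False by (intro R(3)[of x]) auto
      then show ?thesis by auto
    qed
  qed
  also have "\<dots> = F b - F a" by (rule additive_tagged_division_1[OF ab p(1)])
  finally show "F a \<le> F b + e" using S e1(2) by linarith
qed

section \<open>Locally Lipschitz functions and the monotonicity criterion for them\<close>

definition locally_lipschitz :: "(real \<Rightarrow> real) \<Rightarrow> bool" where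
  "locally_lipschitz F \<longleftrightarrow> (\<forall>a b. \<exists>L. L-lipschitz_on {a..b} F)"

lemma locally_lipschitz_continuous:
  assumes "locally_lipschitz F" shows "continuous_on A F"
proof -
  have "isCont F x" for x
  proof -
    obtain L where "L-lipschitz_on {x - 1..x + 1} F"
      using assms by (auto simp: locally_lipschitz_def)
    then have "continuous_on {x - 1..x + 1} F" by (rule lipschitz_on_continuous_on)
    then show ?thesis by (rule continuous_on_interior) simp
  qed
  then show ?thesis by (simp add: continuous_at_imp_continuous_on)
qed

lemma locally_lipschitz_C1:
  assumes "\<And>x. (F has_real_derivative F' x) (at x)" "continuous_on UNIV F'"
  shows "locally_lipschitz F"
  unfolding locally_lipschitz_def
proof (intro allI)
  fix a b
  have "bounded (F' ` {a..b})"
    using assms(2) by (intro compact_imp_bounded compact_continuous_image) (auto intro: continuous_on_subset)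
  then obtain B where B: "B > 0" "\<And>x. x \<in> {a..b} \<Longrightarrow> norm (F' x) \<le> B"
    by (auto simp: bounded_pos)
  have "B-lipschitz_on {a..b} F"
  proof (rule lipschitz_onI)
    fix x y assume "x \<in> {a..b}" "y \<in> {a..b}"
    then have "norm (F x - F y) \<le> B * norm (x - y)"
      by (intro field_differentiable_bound[of "{a..b}" F F' B])
         (use B(2) in \<open>auto intro: has_field_derivative_at_within assms(1)\<close>)
    then show "dist (F x) (F y) \<le> B * dist x y" by (simp add: dist_norm)
  qed (use B in auto)
  then show "\<exists>L. L-lipschitz_on {a..b} F" by blast
qed

lemma locally_lipschitz_add:
  assumes "locally_lipschitz F" "locally_lipschitz G"
  shows "locally_lipschitz (\<lambda>x. F x + G x)"
  unfolding locally_lipschitz_def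
proof (intro allI)
  fix a b
  obtain L M where "L-lipschitz_on {a..b} F" "M-lipschitz_on {a..b} G"
    using assms(1)[unfolded locally_lipschitz_def, rule_format, of a b]
      assms(2)[unfolded locally_lipschitz_def, rule_format, of a b] by auto
  then have "(L + M)-lipschitz_on {a..b} (\<lambda>x. F x + G x)" by (rule lipschitz_on_add)
  then show "\<exists>L. L-lipschitz_on {a..b} (\<lambda>x. F x + G x)" ..
qed

text \<open>Used to multiply by powers of \<open>\<delta>\<^sup>2 + x\<^sup>2\<close>, which are
  smooth but need not be Lipschitz on the whole line; compact intervals make both factors
  bounded.\<close>

lemma locally_lipschitz_mult:
  assumes F: "locally_lipschitz F" and G: "locally_lipschitz G"
  shows "locally_lipschitz (\<lambda>x. F x * G x)"
  unfolding locally_lipschitz_def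
proof (intro allI)
  fix a b
  have bd: "\<exists>B>0. \<forall>x\<in>{a..b}. \<bar>H x\<bar> \<le> B" if "locally_lipschitz H" for H
    using compact_imp_bounded[OF compact_continuous_image[OF locally_lipschitz_continuous[OF that]], of "{a..b}"]
    by (auto simp: bounded_pos)
  obtain B C where B: "B > 0" "\<And>x. x \<in> {a..b} \<Longrightarrow> \<bar>F x\<bar> \<le> B"
    and C: "C > 0" "\<And>x. x \<in> {a..b} \<Longrightarrow> \<bar>G x\<bar> \<le> C" using bd[OF F] bd[OF G] by blast
  obtain L M where L: "L-lipschitz_on {a..b} F" and M: "M-lipschitz_on {a..b} G"
    using F[unfolded locally_lipschitz_def, rule_format, of a b]
      G[unfolded locally_lipschitz_def, rule_format, of a b] by auto
  have "(B * M + C * L)-lipschitz_on {a..b} (\<lambda>x. F x * G x)"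
  proof (rule lipschitz_onI)
    fix x y assume xy: "x \<in> {a..b}" "y \<in> {a..b}"
    have "F x * G x - F y * G y = F x * (G x - G y) + G y * (F x - F y)" by (simp add: algebra_simps)
    also have "\<bar>\<dots>\<bar> \<le> \<bar>F x\<bar> * \<bar>G x - G y\<bar> + \<bar>G y\<bar> * \<bar>F x - F y\<bar>"
      by (metis abs_mult abs_triangle_ineq)
    also have "\<dots> \<le> B * (M * \<bar>x - y\<bar>) + C * (L * \<bar>x - y\<bar>)"
      using lipschitz_onD[OF L xy] lipschitz_onD[OF M xy] B C xy
      by (intro add_mono mult_mono) (auto simp: dist_real_def)
    finally show "dist (F x * G x) (F y * G y) \<le> (B * M + C * L) * dist x y"
      by (simp add: dist_real_def algebra_simps)
  qed (use B C lipschitz_on_nonneg[OF L] lipschitz_on_nonneg[OF M] in auto)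
  then show "\<exists>L. L-lipschitz_on {a..b} (\<lambda>x. F x * G x)" by blast
qed

lemma locally_lipschitz_const: "locally_lipschitz (\<lambda>x. c)"
  by (rule locally_lipschitz_C1[of _ "\<lambda>_. 0"]) auto

lemma locally_lipschitz_ident: "locally_lipschitz (\<lambda>x. x)"
  by (rule locally_lipschitz_C1[of _ "\<lambda>_. 1"]) auto

lemma locally_lipschitz_reflect:
  assumes "locally_lipschitz F"
  shows "locally_lipschitz (\<lambda>x. F (- x))"
  unfolding locally_lipschitz_def
proof (intro allI)
  fix a b
  obtain L where L: "L-lipschitz_on {-b..-a} F"
    using assms by (auto simp: locally_lipschitz_def)
  have "L-lipschitz_on {a..b} (\<lambda>x. F (- x))"
  proof (rule lipschitz_onI)
    fix x y assume "x \<in> {a..b}" "y \<in> {a..b}"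
    then have "dist (F (- x)) (F (- y)) \<le> L * dist (- x) (- y)"
      by (intro lipschitz_onD[OF L]) auto
    then show "dist (F (- x)) (F (- y)) \<le> L * dist x y" by (simp add: dist_real_def abs_minus_commute)
  qed (rule lipschitz_on_nonneg[OF L])
  then show "\<exists>L. L-lipschitz_on {a..b} (\<lambda>x. F (- x))" by blast
qed

lemma lipschitz_imp_abs_cont_on:
  assumes L: "L-lipschitz_on {a..b} F"
  shows "abs_cont_on a b F"
  unfolding abs_cont_on_def
proof (intro allI impI)
  fix e :: real assume e: "e > 0"
  have L0: "L \<ge> 0" using L by (rule lipschitz_on_nonneg)
  show "\<exists>\<eta>>0. \<forall>I :: (real \<times> real) set. finite I \<longrightarrow>
        (\<forall>(u, v)\<in>I. a \<le> u \<and> u < v \<and> v \<le> b) \<longrightarrow>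
        pairwise (\<lambda>(u, v) (u', v'). disjnt {u<..<v} {u'<..<v'}) I \<longrightarrow>
        (\<Sum>(u, v)\<in>I. v - u) < \<eta> \<longrightarrow> (\<Sum>(u, v)\<in>I. \<bar>F v - F u\<bar>) < e"
  \<comment> \<open>\<open>L + 1\<close> instead of \<open>L\<close> keeps this positive when
    \<open>L = 0\<close>.\<close>
  proof (intro exI[of _ "e / (L + 1)"] conjI allI impI)
    show "e / (L + 1) > 0" using e L0 by simp
    fix I :: "(real \<times> real) set"
    assume I: "finite I" "\<forall>(u, v)\<in>I. a \<le> u \<and> u < v \<and> v \<le> b" "(\<Sum>(u, v)\<in>I. v - u) < e / (L + 1)"
    have "(\<Sum>(u, v)\<in>I. \<bar>F v - F u\<bar>) \<le> (\<Sum>(u, v)\<in>I. L * (v - u))"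
    proof (rule sum_mono, clarify)
      fix u v assume "(u, v) \<in> I"
      then have "a \<le> u" "u < v" "v \<le> b" using I(2) by auto
      then show "\<bar>F v - F u\<bar> \<le> L * (v - u)"
        using lipschitz_onD[OF L, of v u] by (simp add: dist_real_def)
    qed
    also have "\<dots> = L * (\<Sum>(u, v)\<in>I. v - u)" by (simp add: sum_distrib_left case_prod_unfold)
    also have "\<dots> \<le> (L + 1) * (\<Sum>(u, v)\<in>I. v - u)"
      using I(2) by (intro mult_right_mono sum_nonneg) auto
    also have "\<dots> < e" using I(3) L0 by (simp add: field_simps)
    finally show "(\<Sum>(u, v)\<in>I. \<bar>F v - F u\<bar>) < e" .
  qed
qed

lemma AE_lborel_negligibleE:
  assumes "AE x in lborel. P x"
  obtains N where "negligible N" "\<And>x :: 'a :: euclidean_space. x \<notin> N \<Longrightarrow> P x"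
proof -
  obtain N where "{x \<in> space lborel. \<not> P x} \<subseteq> N" "N \<in> null_sets lborel"
    using assms by (auto simp: eventually_ae_filter)
  moreover from this have "negligible N"
    by (simp add: negligible_iff_null_sets null_sets_completionI)
  ultimately show ?thesis using that by auto
qed

lemma locally_lipschitz_AE_deriv_nonneg_imp_mono:
  assumes "locally_lipschitz F"
    and "AE x in lborel. \<exists>D\<ge>0. (F has_real_derivative D) (at x)"
  shows "mono F"
proof (rule monoI)
  fix x y :: real assume "x \<le> y"
  obtain N where N: "negligible N" "\<And>x. x \<notin> N \<Longrightarrow> \<exists>D\<ge>0. (F has_real_derivative D) (at x)"
    using AE_lborel_negligibleE[OF assms(2)] by blast
  obtain L where "L-lipschitz_on {x..y} F" using assms(1) by (auto simp: locally_lipschitz_def)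
  then show "F x \<le> F y"
    using abs_cont_on_deriv_nonneg_imp_le[OF \<open>x \<le> y\<close> lipschitz_imp_abs_cont_on N(1)] N(2) by blast
qed

section \<open>Tail integrals of the Student weight\<close>

text \<open>
  \<open>W x\<close> is the integral of \<open>(\<delta>\<^sup>2 + t\<^sup>2) powr (- (d + 1) / 2)\<close> over \<open>t \<le> x\<close>, but characterised
  as an antiderivative vanishing at \<open>- \<infinity>\<close>, so that no integrability has to be checked when
  \<open>d\<close> is lowered by 2; the value at 0 is half of the Beta integral.
\<close>

definition stein_weight_tail :: "real \<Rightarrow> real \<Rightarrow> (real \<Rightarrow> real) \<Rightarrow> bool" where
  "stein_weight_tail \<delta> d W \<longleftrightarrow>
     (\<forall>x. (W has_real_derivative (\<delta>\<^sup>2 + x\<^sup>2) powr (- (d + 1) / 2)) (at x)) \<and>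
     (W \<longlongrightarrow> 0) at_bot \<and>
     W 0 = sqrt pi / 2 * \<delta> powr (- d) * (Gamma (d / 2) / Gamma ((d + 1) / 2))"

section \<open>Powers of the weight and their derivatives\<close>

lemma weight_powr_split:
  fixes d \<delta> x :: real
  assumes "\<delta> > 0"
  shows "(\<delta>\<^sup>2 + x\<^sup>2) powr (- (d - 1) / 2) = (\<delta>\<^sup>2 + x\<^sup>2) * (\<delta>\<^sup>2 + x\<^sup>2) powr (- (d + 1) / 2)"
    and "(\<delta>\<^sup>2 + x\<^sup>2) powr ((d - 1) / 2) * (\<delta>\<^sup>2 + x\<^sup>2) powr (- (d - 1) / 2) = 1"
proof -
  have w: "\<delta>\<^sup>2 + x\<^sup>2 > 0" using assms by (simp add: add_pos_nonneg)
  have "- (d - 1) / 2 = 1 + (- (d + 1) / 2)" by (simp add: field_simps)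
  then show "(\<delta>\<^sup>2 + x\<^sup>2) powr (- (d - 1) / 2) = (\<delta>\<^sup>2 + x\<^sup>2) * (\<delta>\<^sup>2 + x\<^sup>2) powr (- (d + 1) / 2)"
    using w by (simp only: powr_add) simp
  have "(\<delta>\<^sup>2 + x\<^sup>2) powr ((d - 1) / 2) * (\<delta>\<^sup>2 + x\<^sup>2) powr (- (d - 1) / 2) = (\<delta>\<^sup>2 + x\<^sup>2) powr 0"
    by (subst powr_add[symmetric]) (simp add: field_simps)
  also have "\<dots> = 1" using w by (metis less_irrefl powr_zero_eq_one)
  finally show "(\<delta>\<^sup>2 + x\<^sup>2) powr ((d - 1) / 2) * (\<delta>\<^sup>2 + x\<^sup>2) powr (- (d - 1) / 2) = 1" .
qed

text \<open>The parameter is instantiated freely later on: \<open>2 - d\<close> gives the power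
  \<open>(d - 1) / 2\<close>, \<open>d + 1\<close> a comparison function for the decay estimate, and
  \<open>3\<close> the reciprocal of \<open>\<delta>\<^sup>2 + x\<^sup>2\<close>.\<close>

lemma weight_powr_deriv:
  fixes d \<delta> x :: real
  assumes "\<delta> > 0"
  shows "((\<lambda>x. (\<delta>\<^sup>2 + x\<^sup>2) powr (- (d - 1) / 2)) has_real_derivative
           - (d - 1) * x * (\<delta>\<^sup>2 + x\<^sup>2) powr (- (d + 1) / 2)) (at x)"
proof -
  have w: "\<delta>\<^sup>2 + x\<^sup>2 > 0" using assms by (simp add: add_pos_nonneg)
  have e: "- (d - 1) / 2 - 1 = - (d + 1) / 2" by (simp add: field_simps)
  show ?thesis
    by (rule derivative_eq_intros refl w | simp only: of_nat_numeral)+ (simp add: e powr_diff[symmetric] w field_simps)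
qed

text \<open>The reduction formula from one integration by parts. The boundary term is at most of
  order \<open>(\<delta>\<^sup>2 + x\<^sup>2) powr (- (d - 2) / 2)\<close>, hence vanishes at minus
  infinity as \<open>d > 2\<close>; it is zero at 0, so the value there follows from the functional
  equation of \<open>Gamma\<close> applied to both arguments.\<close>

lemma stein_weight_tail_step:
  assumes W: "stein_weight_tail \<delta> d W" and "\<delta> > 0" and d: "d > 2"
  shows "\<exists>W'. stein_weight_tail \<delta> (d - 2) W'"
proof
  \<comment> \<open>from the derivative of \<open>x * (\<delta>\<^sup>2 + x\<^sup>2) powr (- (d - 1) / 2)\<close>\<close>
  let ?W' = "\<lambda>x. ((d - 1) * \<delta>\<^sup>2 * W x - x * (\<delta>\<^sup>2 + x\<^sup>2) powr (- (d - 1) / 2)) / (d - 2)"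
  have "(?W' has_real_derivative (\<delta>\<^sup>2 + x\<^sup>2) powr (- (d - 2 + 1) / 2)) (at x)" for x
  proof -
    define u where "u = (\<delta>\<^sup>2 + x\<^sup>2) powr (- (d + 1) / 2)"
    have e: "- (d - 2 + 1) / 2 = - (d - 1) / 2" by simp
    have dW: "(W has_real_derivative u) (at x)" using W by (simp add: stein_weight_tail_def u_def)
    have "(?W' has_real_derivative ((d - 1) * \<delta>\<^sup>2 * u - (1 * ((\<delta>\<^sup>2 + x\<^sup>2) * u) + (- (d - 1) * x * u) * x)) / (d - 2)) (at x)"
      unfolding u_def weight_powr_split(1)[OF \<open>\<delta> > 0\<close>, symmetric]
      by (intro DERIV_cdivide DERIV_diff DERIV_cmult DERIV_mult DERIV_ident weight_powr_deriv dW[unfolded u_def] assms)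
    also have "((d - 1) * \<delta>\<^sup>2 * u - (1 * ((\<delta>\<^sup>2 + x\<^sup>2) * u) + (- (d - 1) * x * u) * x)) / (d - 2) = (\<delta>\<^sup>2 + x\<^sup>2) * u"
      using d by (simp add: field_simps power2_eq_square)
    finally show ?thesis unfolding u_def weight_powr_split(1)[OF \<open>\<delta> > 0\<close>, symmetric] e .
  qed
  moreover have "(?W' \<longlongrightarrow> 0) at_bot"
  proof -
    have "((\<lambda>x. x * (\<delta>\<^sup>2 + x\<^sup>2) powr (- (d - 1) / 2)) \<longlongrightarrow> 0) at_bot"
    proof (rule Lim_null_comparison)
      show "\<forall>\<^sub>F x in at_bot. norm (x * (\<delta>\<^sup>2 + x\<^sup>2) powr (- (d - 1) / 2)) \<le> (\<delta>\<^sup>2 + x\<^sup>2) powr (- (d - 2) / 2)"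
      proof (intro always_eventually allI)
        fix x :: real
        have "\<bar>x\<bar> \<le> (\<delta>\<^sup>2 + x\<^sup>2) powr (1 / 2)"
          by (simp add: powr_half_sqrt real_le_rsqrt)
        then have "\<bar>x\<bar> * (\<delta>\<^sup>2 + x\<^sup>2) powr (- (d - 1) / 2) \<le> (\<delta>\<^sup>2 + x\<^sup>2) powr (1 / 2) * (\<delta>\<^sup>2 + x\<^sup>2) powr (- (d - 1) / 2)"
          by (intro mult_right_mono) auto
        also have "\<dots> = (\<delta>\<^sup>2 + x\<^sup>2) powr (- (d - 2) / 2)"
          by (subst powr_add[symmetric]) (simp add: field_simps)
        finally show "norm (x * (\<delta>\<^sup>2 + x\<^sup>2) powr (- (d - 1) / 2)) \<le> (\<delta>\<^sup>2 + x\<^sup>2) powr (- (d - 2) / 2)"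
          by (simp add: abs_mult)
      qed
      show "((\<lambda>x. (\<delta>\<^sup>2 + x\<^sup>2) powr (- (d - 2) / 2)) \<longlongrightarrow> 0) at_bot"
        using d \<open>\<delta> > 0\<close> by real_asymp
    qed
    moreover have "(W \<longlongrightarrow> 0) at_bot" using W by (simp add: stein_weight_tail_def)
    ultimately have "(?W' \<longlongrightarrow> ((d - 1) * \<delta>\<^sup>2 * 0 - 0) / (d - 2)) at_bot"
      using d by (intro tendsto_intros) auto
    then show ?thesis by simp
  qed
  moreover have "?W' 0 = sqrt pi / 2 * \<delta> powr (- (d - 2)) * (Gamma ((d - 2) / 2) / Gamma ((d - 2 + 1) / 2))"
  proof -
    have G1: "Gamma (d / 2) = (d - 2) / 2 * Gamma ((d - 2) / 2)"
      using Gamma_plus1[of "(d - 2) / 2"] nonpos_Ints_nonpos[of "(d - 2) / 2"] d by (force simp: field_simps)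
    have G2: "Gamma ((d + 1) / 2) = (d - 1) / 2 * Gamma ((d - 1) / 2)"
      using Gamma_plus1[of "(d - 1) / 2"] nonpos_Ints_nonpos[of "(d - 1) / 2"] d by (force simp: field_simps)
    have p: "\<delta> powr (- (d - 2)) = \<delta>\<^sup>2 * \<delta> powr (- d)"
      using \<open>\<delta> > 0\<close> by (simp add: powr_diff powr_minus field_simps)
    have ratio: "Gamma (d / 2) / Gamma ((d + 1) / 2) =
        (d - 2) / (d - 1) * (Gamma ((d - 2) / 2) / Gamma ((d - 1) / 2))"
      unfolding G1 G2 by simp
    have "?W' 0 = (d - 1) * \<delta>\<^sup>2 * (sqrt pi / 2 * \<delta> powr (- d) * (Gamma (d / 2) / Gamma ((d + 1) / 2))) / (d - 2)"
      using W by (simp add: stein_weight_tail_def)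
    also have "\<dots> = sqrt pi / 2 * (\<delta>\<^sup>2 * \<delta> powr (- d)) * (Gamma ((d - 2) / 2) / Gamma ((d - 1) / 2))"
      unfolding ratio using d by simp
    finally show ?thesis unfolding p by simp
  qed
  ultimately show "stein_weight_tail \<delta> (d - 2) ?W'" unfolding stein_weight_tail_def by blast
qed

text \<open>To the left of \<open>x\<close> the function is nondecreasing, so its limit at minus
  infinity is a lower bound. Applied to the difference of an explicit function and a tail, this
  replaces integrating an inequality between derivatives.\<close>

lemma deriv_nonneg_at_bot_imp_nonneg:
  fixes F :: "real \<Rightarrow> real"
  assumes "\<And>y. y \<le> x \<Longrightarrow> \<exists>D. (F has_real_derivative D) (at y) \<and> D \<ge> 0" "(F \<longlongrightarrow> 0) at_bot"
  shows "F x \<ge> 0"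
proof (rule tendsto_upperbound[OF assms(2)])
  show "\<forall>\<^sub>F y in at_bot. F y \<le> F x"
    using eventually_le_at_bot[of x]
    by eventually_elim (auto intro: DERIV_nonneg_imp_nondecreasing assms(1))
qed simp

lemma stein_weight_tail_nonneg:
  assumes "stein_weight_tail \<delta> d W"
  shows "W x \<ge> 0"
  using assms unfolding stein_weight_tail_def
  by (intro deriv_nonneg_at_bot_imp_nonneg) (auto intro: exI[of _ "_ powr _"])

text \<open>
  A Mills-ratio estimate; it says that \<open>(\<delta>\<^sup>2 + x\<^sup>2) powr ((d - 1) / 2) * W x\<close> is nondecreasing on
  \<open>x \<le> 0\<close>.
\<close>

lemma stein_weight_tail_mills:
  assumes W: "stein_weight_tail \<delta> d W" and \<delta>: "\<delta> > 0" and x: "x \<le> 0"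
  shows "(d - 1) * x * W x + (\<delta>\<^sup>2 + x\<^sup>2) powr (- (d - 1) / 2) \<ge> 0"
proof (cases "d > 1 \<and> x < 0")
  case False
  have "(d - 1) * x \<ge> 0" using False x by (auto simp: zero_le_mult_iff)
  then have "(d - 1) * x * W x \<ge> 0" using stein_weight_tail_nonneg[OF W] by simp
  then show ?thesis by (simp add: add_nonneg_nonneg)
next
  case True
  then have d: "d > 1" and x: "x < 0" by auto
  \<comment> \<open>The claim at \<open>x\<close> is exactly \<open>W x \<le> V x\<close>. The
    derivative of \<open>V\<close> is the weight plus the nonnegative term that comes from
    differentiating \<open>inverse y\<close>, and \<open>V\<close> vanishes at minus
    infinity.\<close>
  define V where "V = (\<lambda>y::real. (\<delta>\<^sup>2 + y\<^sup>2) powr (- (d - 1) / 2) * (- 1 / (d - 1) * inverse y))"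
  have "V x - W x \<ge> 0"
  proof (rule deriv_nonneg_at_bot_imp_nonneg[where F = "\<lambda>x. V x - W x"])
    fix y assume "y \<le> x"
    then have y: "y < 0" using x by simp
    define u where "u = (\<delta>\<^sup>2 + y\<^sup>2) powr (- (d + 1) / 2)"
    have dW: "(W has_real_derivative u) (at y)" using W by (simp add: stein_weight_tail_def u_def)
    have "(V has_real_derivative (- (d - 1) * y * u) * (- 1 / (d - 1) * inverse y) +
        (- 1 / (d - 1) * - (inverse (y ^ Suc (Suc 0)))) * (\<delta>\<^sup>2 + y\<^sup>2) powr (- (d - 1) / 2)) (at y)"
      unfolding V_def u_def using y
      by (intro DERIV_mult weight_powr_deriv \<delta> DERIV_cmult) (use DERIV_inverse[of y] in auto)
    moreover have "(- (d - 1) * y * u) * (- 1 / (d - 1) * inverse y) = u" using y d by (simp add: field_simps)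
    moreover have "(- 1 / (d - 1) * - (inverse (y ^ Suc (Suc 0)))) * (\<delta>\<^sup>2 + y\<^sup>2) powr (- (d - 1) / 2) \<ge> 0"
    proof -
      have "- 1 / (d - 1) * - (inverse (y ^ Suc (Suc 0))) = 1 / ((d - 1) * y\<^sup>2)"
        using y d by (simp add: field_simps power2_eq_square)
      then show ?thesis using d by (simp only:) simp
    qed
    ultimately show "\<exists>D. ((\<lambda>x. V x - W x) has_real_derivative D) (at y) \<and> 0 \<le> D"
      using DERIV_diff[OF _ dW] by (metis add_diff_cancel_left')
  next
    have "(V \<longlongrightarrow> 0) at_bot" unfolding V_def using d \<delta> by real_asymp
    moreover have "(W \<longlongrightarrow> 0) at_bot" using W by (simp add: stein_weight_tail_def)
    ultimately show "((\<lambda>x. V x - W x) \<longlongrightarrow> 0) at_bot" using tendsto_diff by fastforce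
  qed
  then have "(d - 1) * (- x) * W x \<le> (d - 1) * (- x) * V x"
    using x d by (intro mult_left_mono) (auto simp: mult_nonneg_nonpos)
  also have "\<dots> = (\<delta>\<^sup>2 + x\<^sup>2) powr (- (d - 1) / 2)" using x d by (simp add: V_def)
  finally show ?thesis by simp
qed

text \<open>The derivative of the left-hand side is a nonnegative power of the weight times the
  expression in the Mills estimate. The function therefore increases up to 0, where the
  normalisation of \<open>W\<close> supplies the constant.\<close>

lemma stein_weight_tail_bound:
  assumes W: "stein_weight_tail \<delta> d W" and \<delta>: "\<delta> > 0" and x: "x \<le> 0"
  shows "(\<delta>\<^sup>2 + x\<^sup>2) powr ((d - 1) / 2) * W x \<le> sqrt pi / (2 * \<delta>) * (Gamma (d / 2) / Gamma ((d + 1) / 2))"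
proof -
  have "(\<delta>\<^sup>2 + x\<^sup>2) powr ((d - 1) / 2) * W x \<le> (\<delta>\<^sup>2 + 0\<^sup>2) powr ((d - 1) / 2) * W 0"
  proof (rule DERIV_nonneg_imp_nondecreasing[OF x])
    fix y :: real assume "x \<le> y" and y: "y \<le> 0"
    define u where "u = (\<delta>\<^sup>2 + y\<^sup>2) powr (- (d + 1) / 2)"
    have dW: "(W has_real_derivative u) (at y)" using W by (simp add: stein_weight_tail_def u_def)
    have w: "\<delta>\<^sup>2 + y\<^sup>2 > 0" using \<delta> by (simp add: add_pos_nonneg)
    \<comment> \<open>The power with exponent \<open>(d - 3) / 2\<close>, spelled so that the
      derivative rule applies with \<open>2 - d\<close> as parameter.\<close>
    define v where "v = (\<delta>\<^sup>2 + y\<^sup>2) powr (- ((2 - d) + 1) / 2)"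
    have dw: "((\<lambda>x. (\<delta>\<^sup>2 + x\<^sup>2) powr ((d - 1) / 2)) has_real_derivative (d - 1) * y * v) (at y)"
      using weight_powr_deriv[OF \<delta>, of "2 - d" y] unfolding v_def by (simp add: algebra_simps)
    have v: "(\<delta>\<^sup>2 + y\<^sup>2) powr ((d - 1) / 2) = (\<delta>\<^sup>2 + y\<^sup>2) * v"
      using weight_powr_split(1)[OF \<delta>, of y "2 - d"] unfolding v_def by simp
    have D: "((\<lambda>x. (\<delta>\<^sup>2 + x\<^sup>2) powr ((d - 1) / 2) * W x) has_real_derivative
       (d - 1) * y * v * W y + u * ((\<delta>\<^sup>2 + y\<^sup>2) powr ((d - 1) / 2))) (at y)"
      by (rule DERIV_mult[OF dw dW])
    have "(d - 1) * y * v * W y + u * ((\<delta>\<^sup>2 + y\<^sup>2) powr ((d - 1) / 2)) = 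
        v * ((d - 1) * y * W y + (\<delta>\<^sup>2 + y\<^sup>2) powr (- (d - 1) / 2))"
      unfolding v weight_powr_split(1)[OF \<delta>] u_def by (simp add: algebra_simps)
    also have "\<dots> \<ge> 0" using stein_weight_tail_mills[OF W \<delta> y] by (auto simp: v_def)
    finally show "\<exists>D. ((\<lambda>x. (\<delta>\<^sup>2 + x\<^sup>2) powr ((d - 1) / 2) * W x) has_real_derivative D) (at y) \<and> D \<ge> 0"
      using D by blast
  qed
  also have "(\<delta>\<^sup>2 + 0\<^sup>2) powr ((d - 1) / 2) * W 0 = sqrt pi / (2 * \<delta>) * (Gamma (d / 2) / Gamma ((d + 1) / 2))"
  proof -
    have "(\<delta>\<^sup>2) powr ((d - 1) / 2) = \<delta> powr (d - 1)"
      using \<delta> powr_powr[of \<delta> 2 "(d - 1) / 2"] by (simp add: diff_divide_distrib)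
    moreover have "\<delta> powr (d - 1) * \<delta> powr (- d) = 1 / \<delta>"
      using \<delta> by (simp add: powr_diff powr_minus field_simps)
    moreover have "W 0 = sqrt pi / 2 * \<delta> powr (- d) * (Gamma (d / 2) / Gamma ((d + 1) / 2))"
      using W by (simp add: stein_weight_tail_def)
    ultimately have "(\<delta>\<^sup>2 + 0\<^sup>2) powr ((d - 1) / 2) * W 0 = (1 / \<delta>) * (sqrt pi / 2 * (Gamma (d / 2) / Gamma ((d + 1) / 2)))"
      by (simp del: times_divide_eq_left times_divide_eq_right add: mult_ac)
    then show ?thesis by simp
  qed
  finally show ?thesis .
qed

text \<open>Far out, \<open>W\<close> is compared with \<open>2 / d\<close> times the power
  \<open>- d / 2\<close> of the weight, which leaves a quotient of order
  \<open>1 / \<bar>x\<bar>\<close>; on \<open>- \<delta> \<le> x\<close> the uniform bound suffices.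
  This is the source of the boundedness of \<open>x * \<phi> x\<close>.\<close>

lemma stein_weight_tail_decay:
  assumes W: "stein_weight_tail \<delta> d W" and \<delta>: "\<delta> > 0" and d: "d > 0"
  shows "\<exists>C. \<forall>x\<le>0. \<bar>x\<bar> * ((\<delta>\<^sup>2 + x\<^sup>2) powr ((d - 1) / 2) * W x) \<le> C"
proof -
  let ?c = "sqrt pi / (2 * \<delta>) * (Gamma (d / 2) / Gamma ((d + 1) / 2))"
  have "\<bar>x\<bar> * ((\<delta>\<^sup>2 + x\<^sup>2) powr ((d - 1) / 2) * W x) \<le> max (2 / d) (\<delta> * ?c)" if x: "x \<le> 0" for x
  proof (cases "x \<ge> - \<delta>")
    case True
    then have "\<bar>x\<bar> * ((\<delta>\<^sup>2 + x\<^sup>2) powr ((d - 1) / 2) * W x) \<le> \<delta> * ?c"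
      using x \<delta> stein_weight_tail_nonneg[OF W]
      by (intro mult_mono stein_weight_tail_bound[OF W \<delta> x]) auto
    then show ?thesis by simp
  next
    case False
    have w: "\<delta>\<^sup>2 + y\<^sup>2 > 0" for y :: real using \<delta> by (simp add: add_pos_nonneg)
    \<comment> \<open>The factor 2 is what makes the derivatives comparable:
      \<open>sqrt (\<delta>\<^sup>2 + y\<^sup>2) \<le> 2 * \<bar>y\<bar>\<close> as soon as
      \<open>\<bar>y\<bar> \<ge> \<delta>\<close>. The exponent is spelled for the derivative rule
      with parameter \<open>d + 1\<close>.\<close>
    have "2 / d * (\<delta>\<^sup>2 + x\<^sup>2) powr (- (d + 1 - 1) / 2) - W x \<ge> 0"
    proof (rule deriv_nonneg_at_bot_imp_nonneg[where F = "\<lambda>x. 2 / d * (\<delta>\<^sup>2 + x\<^sup>2) powr (- (d + 1 - 1) / 2) - W x"])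
      fix y assume "y \<le> x"
      then have y: "y < - \<delta>" using False by simp
      have "((\<lambda>x. 2 / d * (\<delta>\<^sup>2 + x\<^sup>2) powr (- (d + 1 - 1) / 2) - W x) has_real_derivative
         2 / d * (- (d + 1 - 1) * y * (\<delta>\<^sup>2 + y\<^sup>2) powr (- (d + 1 + 1) / 2)) - (\<delta>\<^sup>2 + y\<^sup>2) powr (- (d + 1) / 2)) (at y)"
        using W by (intro DERIV_diff DERIV_cmult weight_powr_deriv \<delta>) (simp add: stein_weight_tail_def)
      moreover have "2 / d * (- (d + 1 - 1) * y * (\<delta>\<^sup>2 + y\<^sup>2) powr (- (d + 1 + 1) / 2)) = 2 * (- y) * (\<delta>\<^sup>2 + y\<^sup>2) powr (- (d + 1 + 1) / 2)"
        using d by simp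
      moreover have "(\<delta>\<^sup>2 + y\<^sup>2) powr (- (d + 1) / 2) = sqrt (\<delta>\<^sup>2 + y\<^sup>2) * (\<delta>\<^sup>2 + y\<^sup>2) powr (- (d + 1 + 1) / 2)"
        using w[of y] by (simp add: powr_half_sqrt[symmetric] powr_add[symmetric] field_simps)
      moreover have "sqrt (\<delta>\<^sup>2 + y\<^sup>2) \<le> 2 * (- y)"
      proof (rule real_le_lsqrt)
        have "\<delta>\<^sup>2 \<le> (- y)\<^sup>2" using y \<delta> by (intro power_mono) auto
        moreover have "(2 * (- y))\<^sup>2 = y\<^sup>2 + 3 * (- y)\<^sup>2" by (simp add: power2_eq_square)
        ultimately show "\<delta>\<^sup>2 + y\<^sup>2 \<le> (2 * (- y))\<^sup>2" using zero_le_power2[of "- y"] by linarith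
      qed (use y \<delta> in auto)
      then have "sqrt (\<delta>\<^sup>2 + y\<^sup>2) * (\<delta>\<^sup>2 + y\<^sup>2) powr (- (d + 1 + 1) / 2) \<le> 2 * (- y) * (\<delta>\<^sup>2 + y\<^sup>2) powr (- (d + 1 + 1) / 2)"
        by (intro mult_right_mono) auto
      ultimately show "\<exists>D. ((\<lambda>x. 2 / d * (\<delta>\<^sup>2 + x\<^sup>2) powr (- (d + 1 - 1) / 2) - W x) has_real_derivative D) (at y) \<and> 0 \<le> D"
        by (metis (no_types, lifting) diff_ge_0_iff_ge)
    next
      have "((\<lambda>x. 2 / d * (\<delta>\<^sup>2 + x\<^sup>2) powr (- (d + 1 - 1) / 2)) \<longlongrightarrow> 0) at_bot" using d \<delta> by real_asymp
      moreover have "(W \<longlongrightarrow> 0) at_bot" using W by (simp add: stein_weight_tail_def)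
      ultimately show "((\<lambda>x. 2 / d * (\<delta>\<^sup>2 + x\<^sup>2) powr (- (d + 1 - 1) / 2) - W x) \<longlongrightarrow> 0) at_bot" using tendsto_diff by fastforce
    qed
    then have "\<bar>x\<bar> * ((\<delta>\<^sup>2 + x\<^sup>2) powr ((d - 1) / 2) * W x) \<le> \<bar>x\<bar> * ((\<delta>\<^sup>2 + x\<^sup>2) powr ((d - 1) / 2) * (2 / d * (\<delta>\<^sup>2 + x\<^sup>2) powr (- (d + 1 - 1) / 2)))"
      by (intro mult_left_mono) auto
    also have "\<dots> = 2 / d * (\<bar>x\<bar> * ((\<delta>\<^sup>2 + x\<^sup>2) powr ((d - 1) / 2 + - (d + 1 - 1) / 2)))"
      unfolding powr_add by simp
    also have "(d - 1) / 2 + - (d + 1 - 1) / 2 = - (1 / 2)" by (simp add: field_simps)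
    also have "\<bar>x\<bar> * (\<delta>\<^sup>2 + x\<^sup>2) powr - (1 / 2) \<le> 1"
    proof -
      have "\<bar>x\<bar> \<le> sqrt (\<delta>\<^sup>2 + x\<^sup>2)" by (rule real_le_rsqrt) simp
      then show ?thesis using w[of x] by (simp add: powr_minus powr_half_sqrt field_simps)
    qed
    finally have "\<bar>x\<bar> * ((\<delta>\<^sup>2 + x\<^sup>2) powr ((d - 1) / 2) * W x) \<le> 2 / d"
      using d by (simp add: divide_right_mono)
    then show ?thesis by simp
  qed
  then show ?thesis by blast
qed

section \<open>The Stein equation with bounded data\<close>

lemma AE_lborel_uminus:
  fixes P :: "real \<Rightarrow> bool"
  assumes "AE x in lborel. P x"
  shows "AE x in lborel. P (- x)"
proof -
  have "AE x in distr lborel borel uminus. P x" using assms by (simp only: lborel_distr_uminus)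
  then show ?thesis by (rule AE_distrD[rotated]) simp
qed

text \<open>Both \<open>R * W + \<psi>\<close> and \<open>R * W - \<psi>\<close> are locally
  Lipschitz with almost everywhere nonnegative derivative and tend to 0 at minus infinity, so both
  are nonnegative. The estimate is used at points \<open>x \<le> 0\<close>, where the weighted tail
  is controlled.\<close>

lemma stein_equation_left_bound:
  assumes W: "stein_weight_tail \<delta> d W" and \<delta>: "\<delta> > 0"
    and \<phi>: "locally_lipschitz \<phi>"
    and eq: "AE x in lborel. \<exists>D. (\<phi> has_real_derivative D) (at x) \<and> \<bar>(\<delta>\<^sup>2 + x\<^sup>2) * D - (d - 1) * x * \<phi> x\<bar> \<le> R"
    and lim: "((\<lambda>x. (\<delta>\<^sup>2 + x\<^sup>2) powr (- (d - 1) / 2) * \<phi> x) \<longlongrightarrow> 0) at_bot"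
  shows "\<bar>\<phi> x\<bar> \<le> R * ((\<delta>\<^sup>2 + x\<^sup>2) powr ((d - 1) / 2) * W x)"
proof -
  define \<psi> where "\<psi> = (\<lambda>x. (\<delta>\<^sup>2 + x\<^sup>2) powr (- (d - 1) / 2) * \<phi> x)"
  let ?u = "\<lambda>x. (\<delta>\<^sup>2 + x\<^sup>2) powr (- (d + 1) / 2)"
  have w: "\<delta>\<^sup>2 + x\<^sup>2 > 0" for x :: real using \<delta> by (simp add: add_pos_nonneg)
  then have w0: "\<delta>\<^sup>2 + x\<^sup>2 \<noteq> 0" for x :: real by (metis less_irrefl)
  have dW: "(W has_real_derivative ?u x) (at x)" for x using W by (simp add: stein_weight_tail_def)
  have cu: "continuous_on UNIV ?u" by (intro continuous_intros ballI w0)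
  have lW: "locally_lipschitz W" using dW cu by (rule locally_lipschitz_C1)
  have l\<psi>: "locally_lipschitz \<psi>"
    unfolding \<psi>_def
    by (intro locally_lipschitz_mult \<phi> locally_lipschitz_C1[OF weight_powr_deriv[OF \<delta>]] continuous_intros ballI w0)
  have pos: "0 \<le> R * W x + s * \<psi> x" if s: "\<bar>s\<bar> = 1" for s x
  proof -
    have "locally_lipschitz (\<lambda>x. R * W x + s * \<psi> x)"
      by (intro locally_lipschitz_add locally_lipschitz_mult locally_lipschitz_const lW l\<psi>)
    moreover have "AE x in lborel. \<exists>E\<ge>0. ((\<lambda>x. R * W x + s * \<psi> x) has_real_derivative E) (at x)"
      using eq
    proof eventually_elim
      case (elim x)
      then obtain D where D: "(\<phi> has_real_derivative D) (at x)" "\<bar>(\<delta>\<^sup>2 + x\<^sup>2) * D - (d - 1) * x * \<phi> x\<bar> \<le> R" by blast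
      have "((\<lambda>x. R * W x + s * \<psi> x) has_real_derivative
         R * ?u x + s * ((- (d - 1) * x * ?u x) * \<phi> x + D * ((\<delta>\<^sup>2 + x\<^sup>2) powr (- (d - 1) / 2)))) (at x)"
        unfolding \<psi>_def by (intro DERIV_add DERIV_cmult DERIV_mult dW weight_powr_deriv \<delta> D)
      also have "R * ?u x + s * ((- (d - 1) * x * ?u x) * \<phi> x + D * ((\<delta>\<^sup>2 + x\<^sup>2) powr (- (d - 1) / 2))) =
         ?u x * (R + s * ((\<delta>\<^sup>2 + x\<^sup>2) * D - (d - 1) * x * \<phi> x))"
        unfolding weight_powr_split(1)[OF \<delta>] by (simp add: algebra_simps)
      finally have *: "((\<lambda>x. R * W x + s * \<psi> x) has_real_derivative \<dots>) (at x)" .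
      have "\<bar>s * ((\<delta>\<^sup>2 + x\<^sup>2) * D - (d - 1) * x * \<phi> x)\<bar> \<le> R" using D(2) s by (simp add: abs_mult)
      then have "R + s * ((\<delta>\<^sup>2 + x\<^sup>2) * D - (d - 1) * x * \<phi> x) \<ge> 0" by linarith
      then have "?u x * (R + s * ((\<delta>\<^sup>2 + x\<^sup>2) * D - (d - 1) * x * \<phi> x)) \<ge> 0"
        by (intro mult_nonneg_nonneg) auto
      then show ?case using * by blast
    qed
    ultimately have mono: "mono (\<lambda>x. R * W x + s * \<psi> x)" by (rule locally_lipschitz_AE_deriv_nonneg_imp_mono)
    have "((\<lambda>x. R * W x + s * \<psi> x) \<longlongrightarrow> R * 0 + s * 0) at_bot"
      using W lim unfolding \<psi>_def by (intro tendsto_intros) (auto simp: stein_weight_tail_def)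
    then have "((\<lambda>x. R * W x + s * \<psi> x) \<longlongrightarrow> 0) at_bot" by simp
    then show ?thesis
    proof (rule tendsto_upperbound)
      show "\<forall>\<^sub>F y in at_bot. R * W y + s * \<psi> y \<le> R * W x + s * \<psi> x"
        using eventually_le_at_bot[of x] by eventually_elim (rule monoD[OF mono])
    qed simp
  qed
  have "\<bar>\<psi> x\<bar> \<le> R * W x" using pos[of 1 x] pos[of "-1" x] by auto
  then have "(\<delta>\<^sup>2 + x\<^sup>2) powr ((d - 1) / 2) * \<bar>\<psi> x\<bar> \<le> (\<delta>\<^sup>2 + x\<^sup>2) powr ((d - 1) / 2) * (R * W x)"
    by (intro mult_left_mono) auto
  moreover have "(\<delta>\<^sup>2 + x\<^sup>2) powr ((d - 1) / 2) * \<bar>\<psi> x\<bar> =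
      ((\<delta>\<^sup>2 + x\<^sup>2) powr ((d - 1) / 2) * (\<delta>\<^sup>2 + x\<^sup>2) powr (- (d - 1) / 2)) * \<bar>\<phi> x\<bar>"
    by (simp add: \<psi>_def abs_mult)
  ultimately show ?thesis unfolding weight_powr_split(2)[OF \<delta>] by (simp add: mult_ac)
qed

text \<open>Under \<open>x \<mapsto> - x\<close> the left side of the Stein equation only changes
  sign, so the reflected function satisfies the same hypotheses and its left bound is the right
  bound of \<open>\<phi>\<close>. The second conclusion provides the decay for the derivative of the
  next order.\<close>

lemma stein_equation_bound:
  assumes W: "stein_weight_tail \<delta> d W" and \<delta>: "\<delta> > 0" and d: "d > 0" and R: "R \<ge> 0"
    and \<phi>: "locally_lipschitz \<phi>"
    and eq: "AE x in lborel. \<exists>D. (\<phi> has_real_derivative D) (at x) \<and> \<bar>(\<delta>\<^sup>2 + x\<^sup>2) * D - (d - 1) * x * \<phi> x\<bar> \<le> R"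
    and bot: "((\<lambda>x. (\<delta>\<^sup>2 + x\<^sup>2) powr (- (d - 1) / 2) * \<phi> x) \<longlongrightarrow> 0) at_bot"
    and top: "((\<lambda>x. (\<delta>\<^sup>2 + x\<^sup>2) powr (- (d - 1) / 2) * \<phi> x) \<longlongrightarrow> 0) at_top"
  shows "\<bar>\<phi> x\<bar> \<le> sqrt pi / (2 * \<delta>) * (Gamma (d / 2) / Gamma ((d + 1) / 2)) * R"
    and "\<exists>C. \<forall>x. \<bar>x * \<phi> x\<bar> \<le> C"
proof -
  let ?K = "\<lambda>x. (\<delta>\<^sup>2 + x\<^sup>2) powr ((d - 1) / 2) * W x"
  have eq': "AE x in lborel. \<exists>D. ((\<lambda>x. \<phi> (- x)) has_real_derivative D) (at x) \<and>
      \<bar>(\<delta>\<^sup>2 + x\<^sup>2) * D - (d - 1) * x * \<phi> (- x)\<bar> \<le> R"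
    using AE_lborel_uminus[OF eq]
  proof eventually_elim
    case (elim x)
    then obtain D where D: "(\<phi> has_real_derivative D) (at (- x))" 
      "\<bar>(\<delta>\<^sup>2 + x\<^sup>2) * D - (d - 1) * (- x) * \<phi> (- x)\<bar> \<le> R" by auto
    have "((\<lambda>x. \<phi> (- x)) has_real_derivative - D) (at x)"
      using D(1) by (simp add: DERIV_mirror)
    moreover have "(\<delta>\<^sup>2 + x\<^sup>2) * (- D) - (d - 1) * x * \<phi> (- x) = - ((\<delta>\<^sup>2 + x\<^sup>2) * D - (d - 1) * (- x) * \<phi> (- x))"
      by (simp add: algebra_simps)
    ultimately show ?case using D(2) by (metis abs_minus_cancel)
  qed
  have top': "((\<lambda>x. (\<delta>\<^sup>2 + x\<^sup>2) powr (- (d - 1) / 2) * \<phi> (- x)) \<longlongrightarrow> 0) at_bot"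
    using top by (simp add: at_top_mirror filterlim_filtermap)
  have half: "\<bar>\<phi> x\<bar> \<le> R * ?K (- \<bar>x\<bar>)" for x
    using stein_equation_left_bound[OF W \<delta> \<phi> eq bot, of x]
      stein_equation_left_bound[OF W \<delta> locally_lipschitz_reflect[OF \<phi>] eq' top', of "- x"]
    by (cases "x \<le> 0") auto
  show "\<bar>\<phi> x\<bar> \<le> sqrt pi / (2 * \<delta>) * (Gamma (d / 2) / Gamma ((d + 1) / 2)) * R" for x
    using half[of x] mult_left_mono[OF stein_weight_tail_bound[OF W \<delta>, of "- \<bar>x\<bar>"] R] by (simp add: mult_ac)
  obtain C where C: "\<And>x. x \<le> 0 \<Longrightarrow> \<bar>x\<bar> * ?K x \<le> C"
    using stein_weight_tail_decay[OF W \<delta> d] by blast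
  have "\<bar>x * \<phi> x\<bar> \<le> R * C" for x
  proof -
    have "\<bar>x * \<phi> x\<bar> \<le> \<bar>x\<bar> * (R * ?K (- \<bar>x\<bar>))" unfolding abs_mult by (intro mult_left_mono half) auto
    also have "\<dots> = R * (\<bar>- \<bar>x\<bar>\<bar> * ?K (- \<bar>x\<bar>))" by (simp add: mult_ac)
    also have "\<dots> \<le> R * C" by (intro mult_left_mono C R) auto
    finally show ?thesis .
  qed
  then show "\<exists>C. \<forall>x. \<bar>x * \<phi> x\<bar> \<le> C" by blast
qed

section \<open>Primitives of bounded integrable functions\<close>

context
  fixes k P :: "real \<Rightarrow> real" and B :: real
  assumes k: "integrable lborel k" and B: "\<And>x. \<bar>k x\<bar> \<le> B"
  defines "P \<equiv> \<lambda>x. LINT t:{..x}|lborel. k t"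
begin

lemma primitive_set_integrable: "A \<in> sets borel \<Longrightarrow> set_integrable lborel A k"
  using k by (intro set_integrable_subset[of lborel UNIV k A]) (auto simp: set_integrable_def)

text \<open>Passes from Lebesgue to gauge integrals, for which the differentiation theorems used
  below are formulated.\<close>

lemma primitive_diff:
  assumes "x \<le> y" shows "P y - P x = integral {x..y} k"
proof -
  have "P y = P x + (LINT t:{x<..y}|lborel. k t)"
    unfolding P_def using assms
    by (subst set_integral_Un[symmetric]) (auto intro: primitive_set_integrable simp: ivl_disj_un)
  also have "(LINT t:{x<..y}|lborel. k t) = integral {x<..y} k"
    by (intro set_borel_integral_eq_integral primitive_set_integrable) simp
  also have "\<dots> = integral {x..y} k"
    by (rule integral_spike_set) (rule negligible_subset[of "{x}"]; force)+
  finally show ?thesis by simp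
qed

lemma primitive_integrable_on: "k integrable_on {x..y}"
  by (intro set_borel_integral_eq_integral(1) primitive_set_integrable) simp

lemma primitive_locally_lipschitz: "locally_lipschitz P"
  unfolding locally_lipschitz_def
proof (intro allI)
  fix a b
  have B0: "B \<ge> 0" using B[of 0] by linarith
  have *: "\<bar>P y - P x\<bar> \<le> B * (y - x)" if "x \<le> y" for x y
    using has_integral_bound_real[OF B0 finite.emptyI integrable_integral[OF primitive_integrable_on[of x y]]] B that
    by (simp add: primitive_diff)
  have "B-lipschitz_on {a..b} P"
    by (rule lipschitz_on_leI) (use * B0 in \<open>auto simp: dist_real_def abs_minus_commute\<close>)
  then show "\<exists>L. L-lipschitz_on {a..b} P" ..
qed

lemma primitive_at_top: "(P \<longlongrightarrow> (LINT t|lborel. k t)) at_top"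
  using tendsto_integral_at_top[OF _ k] by (simp add: P_def set_lebesgue_integral_def)

lemma primitive_at_bot: "(P \<longlongrightarrow> 0) at_bot"
proof -
  have "((\<lambda>a. P 0 - (LINT t:{a..0}|lborel. k t)) \<longlongrightarrow> P 0 - P 0) at_bot"
    unfolding P_def
    by (intro tendsto_diff tendsto_const tendsto_set_lebesgue_integral_at_bot primitive_set_integrable) auto
  moreover have "\<forall>\<^sub>F a in at_bot. P 0 - (LINT t:{a..0}|lborel. k t) = P a"
    using eventually_le_at_bot[of 0]
  proof eventually_elim
    case (elim a)
    have "(LINT t:{a..0}|lborel. k t) = integral {a..0} k"
      by (intro set_borel_integral_eq_integral primitive_set_integrable) simp
    then show ?case using primitive_diff[OF elim] by simp
  qed
  ultimately show ?thesis by (simp add: filterlim_cong)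
qed

lemma primitive_deriv:
  assumes "continuous_on UNIV k"
  shows "(P has_real_derivative k x) (at x)"
proof -
  \<comment> \<open>The base point \<open>x - 1\<close> makes \<open>x\<close> interior to the
    interval, so that the one-sided derivative within it is a full derivative.\<close>
  have "((\<lambda>y. P (x - 1) + integral {x - 1..y} k) has_real_derivative 0 + k x) (at x within {x - 1..x + 1})"
    by (intro DERIV_add DERIV_const integral_has_real_derivative) (auto intro: continuous_on_subset[OF assms])
  then have "((\<lambda>y. P (x - 1) + integral {x - 1..y} k) has_real_derivative k x) (at x)"
    by (subst (asm) at_within_interior) auto
  then show ?thesis
  proof (rule has_field_derivative_transform_within[where d = 1])
    fix y assume "dist y x < 1"
    then have "x - 1 \<le> y" by (simp add: dist_real_def)
    then show "P (x - 1) + integral {x - 1..y} k = P y" using primitive_diff by force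
  qed auto
qed

text \<open>Lebesgue differentiation. Averages over \<open>{x..x + h}\<close> give the right-hand
  difference quotients; the left-hand ones are right-hand averages of the reflected function at
  \<open>- x\<close>. Points outside both exceptional sets have a two-sided derivative.\<close>

lemma primitive_AE_deriv: "AE x in lborel. (P has_real_derivative k x) (at x)"
proof -
  have "k integrable_on cbox a b" for a b using primitive_integrable_on[of a b] by simp
  from integrable_ccontinuous_explicit[OF this]
  obtain N where N: "negligible N" "\<And>x e. x \<notin> N \<Longrightarrow> 0 < e \<Longrightarrow>
     \<exists>d>0. \<forall>h. 0 < h \<and> h < d \<longrightarrow> norm (integral (cbox x (x + h *\<^sub>R One)) k /\<^sub>R h ^ DIM(real) - k x) < e"
    by blast
  have "(\<lambda>x. k (- x)) integrable_on cbox a b" for a b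
    using primitive_integrable_on[of "- b" "- a"] Henstock_Kurzweil_Integration.integrable_reflect_real[of k "- a" "- b"]
    by simp
  from integrable_ccontinuous_explicit[OF this]
  obtain N' where N': "negligible N'" "\<And>x e. x \<notin> N' \<Longrightarrow> 0 < e \<Longrightarrow>
     \<exists>d>0. \<forall>h. 0 < h \<and> h < d \<longrightarrow> norm (integral (cbox x (x + h *\<^sub>R One)) (\<lambda>x. k (- x)) /\<^sub>R h ^ DIM(real) - k (- x)) < e"
    by blast
  have "(P has_real_derivative k x) (at x)" if x: "x \<notin> N" "- x \<notin> N'" for x
    unfolding DERIV_def
  proof (rule LIM_I)
    fix e :: real assume "0 < e"
    obtain d1 where d1: "d1 > 0" "\<And>h. 0 < h \<Longrightarrow> h < d1 \<Longrightarrow> \<bar>integral {x..x + h} k / h - k x\<bar> < e"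
      using N(2)[OF x(1) \<open>0 < e\<close>] by (auto simp: divide_inverse mult.commute)
    obtain d2 where d2: "d2 > 0" "\<And>h. 0 < h \<Longrightarrow> h < d2 \<Longrightarrow> \<bar>integral {- x..- x + h} (\<lambda>x. k (- x)) / h - k x\<bar> < e"
      using N'(2)[OF x(2) \<open>0 < e\<close>] by (auto simp: divide_inverse mult.commute)
    have "norm ((P (x + h) - P x) / h - k x) < e" if "h \<noteq> 0" "norm (h - 0) < min d1 d2" for h
    proof (cases "h > 0")
      case True
      then show ?thesis using d1(2)[of h] that primitive_diff[of x "x + h"] by simp
    next
      case False
      then have h: "h < 0" using that by simp
      have "integral {- x..- x + - h} (\<lambda>x. k (- x)) = integral {x + h..x} k"
        using Henstock_Kurzweil_Integration.integral_reflect_real[of x "x + h" k] by (simp add: algebra_simps)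
      also have "\<dots> = P x - P (x + h)" using primitive_diff[of "x + h" x] h by simp
      finally have "integral {- x..- x + - h} (\<lambda>x. k (- x)) / (- h) = (P (x + h) - P x) / h"
        using h by (simp add: field_simps)
      then show ?thesis using d2(2)[of "- h"] h that by auto
    qed
    then show "\<exists>s>0. \<forall>h. h \<noteq> 0 \<and> norm (h - 0) < s \<longrightarrow> norm ((P (x + h) - P x) / h - k x) < e"
      using d1(1) d2(1) by (intro exI[of _ "min d1 d2"]) auto
  qed
  then have main: "x \<notin> N \<Longrightarrow> - x \<notin> N' \<Longrightarrow> (P has_real_derivative k x) (at x)" for x .
  have ae: "AE x in lborel. x \<notin> S" if "negligible S" for S :: "real set"
    using AE_not_in[of S lebesgue] that by (simp add: negligible_iff_null_sets AE_completion_iff)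
  have "AE x in lborel. x \<notin> N" "AE x in lborel. - x \<notin> N'"
    using ae[OF N(1)] AE_lborel_uminus[OF ae[OF N'(1)]] .
  then show ?thesis by eventually_elim (rule main)
qed

end

section \<open>The Student law and its weight\<close>

lemma student_t_density_eq:
  assumes "\<delta> > 0"
  shows "student_t_density d \<delta> x = Gamma ((d + 1) / 2) / (sqrt pi * Gamma (d / 2)) * \<delta> powr d * (\<delta>\<^sup>2 + x\<^sup>2) powr (- (d + 1) / 2)"
proof -
  have "1 + x\<^sup>2 / \<delta>\<^sup>2 = (\<delta>\<^sup>2 + x\<^sup>2) / \<delta>\<^sup>2" using assms by (simp add: field_simps)
  moreover have "- (1 / 2) * (d + 1) = - (d + 1) / 2" by (simp add: field_simps)
  ultimately have "(1 + x\<^sup>2 / \<delta>\<^sup>2) powr (- (1 / 2) * (d + 1)) = (\<delta>\<^sup>2 + x\<^sup>2) powr (- (d + 1) / 2) / (\<delta>\<^sup>2) powr (- (d + 1) / 2)"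
    by (simp only: powr_divide)
  also have "(\<delta>\<^sup>2) powr (- (d + 1) / 2) = \<delta> powr (- (d + 1))"
  proof -
    have "(\<delta> powr 2) powr (- (d + 1) / 2) = \<delta> powr (- (d + 1))"
      unfolding powr_powr by (rule arg_cong[of _ _ "\<lambda>t. \<delta> powr t"]) simp
    then show ?thesis using assms by simp
  qed
  also have "(\<delta>\<^sup>2 + x\<^sup>2) powr (- (d + 1) / 2) / \<delta> powr (- (d + 1)) = \<delta> * \<delta> powr d * (\<delta>\<^sup>2 + x\<^sup>2) powr (- (d + 1) / 2)"
  proof -
    have "\<delta> powr (- (d + 1)) = inverse (\<delta> * \<delta> powr d)"
      using assms by (simp only: powr_minus powr_add) simp
    then show ?thesis by (simp only: divide_inverse inverse_inverse_eq mult_ac)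
  qed
  finally have "(1 + x\<^sup>2 / \<delta>\<^sup>2) powr (- (1 / 2) * (d + 1)) = \<delta> * (\<delta> powr d * (\<delta>\<^sup>2 + x\<^sup>2) powr (- (d + 1) / 2))"
    by (simp only: mult.assoc)
  moreover have "sqrt (pi * \<delta>\<^sup>2) = sqrt pi * \<delta>" using assms by (simp add: real_sqrt_mult)
  \<comment> \<open>Of the factor \<open>\<delta> powr (d + 1)\<close> pulled out of the power, one
    \<open>\<delta>\<close> cancels the one in the normalising constant.\<close>
  moreover have "a / (b * \<delta> * c) * (\<delta> * e) = a / (b * c) * e" for a b c e :: real
    using assms by simp
  ultimately show ?thesis unfolding student_t_density_def by (simp only: mult.assoc)
qed

text \<open>No Beta integral is evaluated: \<open>Z\<close> having this density under a probability
  measure forces the total mass to be 1, which yields integrability and the value of the weight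
  integral from the constant test function.\<close>

lemma student_t_distributed:
  assumes M: "prob_space M" and d: "d > 0" and \<delta>: "\<delta> > 0"
    and Z: "distributed M lborel Z (\<lambda>x. ennreal (student_t_density d \<delta> x))"
  shows student_t_weight_integrable: "integrable lborel (\<lambda>x. (\<delta>\<^sup>2 + x\<^sup>2) powr (- (d + 1) / 2))" (is "integrable _ ?u")
    and student_t_weight_integral: "(LINT x|lborel. (\<delta>\<^sup>2 + x\<^sup>2) powr (- (d + 1) / 2)) =
       sqrt pi * \<delta> powr (- d) * (Gamma (d / 2) / Gamma ((d + 1) / 2))"
    and student_t_integrable: "\<And>h. h \<in> borel_measurable borel \<Longrightarrow> bounded (range h) \<Longrightarrow>
       integrable lborel (\<lambda>x. (\<delta>\<^sup>2 + x\<^sup>2) powr (- (d + 1) / 2) * h x)"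
    and student_t_centred: "\<And>h. h \<in> borel_measurable borel \<Longrightarrow> bounded (range h) \<Longrightarrow>
       (LINT x|lborel. (\<delta>\<^sup>2 + x\<^sup>2) powr (- (d + 1) / 2) * (h x - prob_space.expectation M (\<lambda>\<omega>. h (Z \<omega>)))) = 0"
proof -
  interpret prob_space M by (rule M)
  have [measurable]: "Z \<in> borel_measurable M" using distributed_measurable[OF Z] by simp
  define c where "c = Gamma ((d + 1) / 2) / (sqrt pi * Gamma (d / 2)) * \<delta> powr d"
  have c: "c > 0" using d \<delta> by (simp add: c_def)
  have p: "student_t_density d \<delta> x = c * ?u x" for x
    unfolding student_t_density_eq[OF \<delta>] c_def by simp
  have p0: "student_t_density d \<delta> x \<ge> 0" for x unfolding p using c by simp
  have int: "integrable lborel (\<lambda>x. ?u x * h x)"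
    and val: "c * (LINT x|lborel. ?u x * h x) = expectation (\<lambda>\<omega>. h (Z \<omega>))"
    if [measurable]: "h \<in> borel_measurable borel" and b: "bounded (range h)" for h
  proof -
    obtain B where "\<And>x. \<bar>h x\<bar> \<le> B" using b by (auto simp: bounded_iff)
    then have "integrable M (\<lambda>\<omega>. h (Z \<omega>))" by (intro integrable_const_bound[of _ B]) auto
    then have "integrable lborel (\<lambda>x. c * (?u x * h x))"
      using distributed_integrable[OF Z, of h] p0 by (simp add: p mult.assoc)
    then show "integrable lborel (\<lambda>x. ?u x * h x)" using c by simp
    show "c * (LINT x|lborel. ?u x * h x) = expectation (\<lambda>\<omega>. h (Z \<omega>))"
      using distributed_integral[OF Z, of h] p0 by (simp add: p mult.assoc)
  qed
  show "\<And>h. h \<in> borel_measurable borel \<Longrightarrow> bounded (range h) \<Longrightarrow> integrable lborel (\<lambda>x. ?u x * h x)"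
    by (rule int)
  show "integrable lborel ?u" using int[of "\<lambda>_. 1"] by simp
  have one: "c * (LINT x|lborel. ?u x) = 1" using val[of "\<lambda>_. 1"] by (simp add: prob_space)
  have "Gamma ((d + 1) / 2) > 0" "Gamma (d / 2) > 0" using d by auto
  then have "c * (sqrt pi * \<delta> powr (- d) * (Gamma (d / 2) / Gamma ((d + 1) / 2))) = 1"
    using \<delta> by (simp add: c_def powr_minus field_simps)
  then show "(LINT x|lborel. ?u x) = sqrt pi * \<delta> powr (- d) * (Gamma (d / 2) / Gamma ((d + 1) / 2))"
    using one c by (metis mult_left_cancel less_irrefl)
  fix h :: "real \<Rightarrow> real" assume h: "h \<in> borel_measurable borel" "bounded (range h)"
  have "(LINT x|lborel. ?u x * (h x - expectation (\<lambda>\<omega>. h (Z \<omega>)))) =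
      (LINT x|lborel. ?u x * h x) - (LINT x|lborel. ?u x * expectation (\<lambda>\<omega>. h (Z \<omega>)))"
    unfolding right_diff_distrib
    by (intro Bochner_Integration.integral_diff int h \<open>integrable lborel ?u\<close> integrable_mult_left)
  also have "\<dots> = (LINT x|lborel. ?u x * h x) - (LINT x|lborel. ?u x) * (c * (LINT x|lborel. ?u x * h x))"
    unfolding val[OF h] by simp
  also have "\<dots> = (LINT x|lborel. ?u x * h x) * (1 - c * (LINT x|lborel. ?u x))" by (simp add: algebra_simps)
  finally show "(LINT x|lborel. ?u x * (h x - expectation (\<lambda>\<omega>. h (Z \<omega>)))) = 0" unfolding one by simp
qed

lemma weight_powr_continuous:
  fixes \<delta> :: real
  assumes "\<delta> > 0"
  shows "continuous_on A (\<lambda>x. (\<delta>\<^sup>2 + x\<^sup>2) powr a)"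
proof -
  have "\<delta>\<^sup>2 + x\<^sup>2 \<noteq> 0" for x :: real using assms by (simp add: add_pos_nonneg order.strict_implies_not_eq[symmetric])
  then show ?thesis by (intro continuous_intros) auto
qed

lemma weight_powr_bounded:
  fixes \<delta> :: real
  assumes "\<delta> > 0" "a \<le> 0"
  shows "(\<delta>\<^sup>2 + x\<^sup>2) powr a \<le> (\<delta>\<^sup>2) powr a"
  using assms by (intro powr_mono2') auto

text \<open>The weight is even, so \<open>W x + W (- x)\<close> is constant; comparing its value at
  0 with its limit at infinity shows that \<open>W 0\<close> is half of the full integral.\<close>

lemma stein_weight_tail_student_t:
  assumes M: "prob_space M" and d: "d > 0" and \<delta>: "\<delta> > 0"
    and Z: "distributed M lborel Z (\<lambda>x. ennreal (student_t_density d \<delta> x))"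
  shows "stein_weight_tail \<delta> d (\<lambda>x. LINT t:{..x}|lborel. (\<delta>\<^sup>2 + t\<^sup>2) powr (- (d + 1) / 2))"
proof -
  let ?u = "\<lambda>x. (\<delta>\<^sup>2 + x\<^sup>2) powr (- (d + 1) / 2)"
  define W where "W = (\<lambda>x. LINT t:{..x}|lborel. ?u t)"
  have B: "\<bar>?u x\<bar> \<le> (\<delta>\<^sup>2) powr (- (d + 1) / 2)" for x
    using weight_powr_bounded[OF \<delta>, of "- (d + 1) / 2" x] d by simp
  note int = student_t_weight_integrable[OF M d \<delta> Z]
  have dW: "(W has_real_derivative ?u x) (at x)" for x
    unfolding W_def by (rule primitive_deriv[OF int B weight_powr_continuous[OF \<delta>]])
  have bot: "(W \<longlongrightarrow> 0) at_bot" unfolding W_def by (rule primitive_at_bot[OF int B])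
  have top: "(W \<longlongrightarrow> (LINT x|lborel. ?u x)) at_top" unfolding W_def by (rule primitive_at_top[OF int B])
  have "((\<lambda>x. W x + W (- x)) has_real_derivative ?u x + - ?u (- x)) (at x)" for x
    using dW[of "- x"] by (intro DERIV_add dW) (simp add: DERIV_mirror)
  then have "((\<lambda>x. W x + W (- x)) has_real_derivative 0) (at x)" for x by simp
  then have "W x + W (- x) = W 0 + W (- 0)" for x
    using DERIV_isconst_all[of "\<lambda>x. W x + W (- x)" x 0] by blast
  moreover have "((\<lambda>x. W x + W (- x)) \<longlongrightarrow> (LINT x|lborel. ?u x) + 0) at_top"
    using bot by (intro tendsto_add top) (simp add: at_bot_mirror filterlim_filtermap)
  ultimately have "((\<lambda>x. W 0 + W 0) \<longlongrightarrow> (LINT x|lborel. ?u x)) (at_top :: real filter)" by simp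
  then have "W 0 + W 0 = (LINT x|lborel. ?u x)" by (simp add: tendsto_const_iff)
  then have "W 0 = sqrt pi / 2 * \<delta> powr (- d) * (Gamma (d / 2) / Gamma ((d + 1) / 2))"
    unfolding student_t_weight_integral[OF M d \<delta> Z] by simp
  then show ?thesis using dW bot unfolding stein_weight_tail_def W_def by blast
qed

section \<open>Derivatives of the Stein solution\<close>

text \<open>An arbitrary sequence \<open>D\<close> takes the place of the norms, so that the
  right-hand side of the theorem can be treated by recursion on \<open>n\<close>.\<close>

definition stein_derivative_bound :: "real \<Rightarrow> real \<Rightarrow> (nat \<Rightarrow> real) \<Rightarrow> nat \<Rightarrow> real" where
  "stein_derivative_bound d \<delta> D n =
     (\<Sum>j=0..n. (sqrt pi / (2 * \<delta>)) ^ (n + 1 - j) * (fact n / fact j) *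
        pochhammer (d - real n) (n - j) *
        (\<Prod>i=j..n. Gamma (d / 2 - real i) / Gamma ((d + 1) / 2 - real i)) * D j)"

lemma stein_derivative_bound_0:
  "stein_derivative_bound d \<delta> D 0 = sqrt pi / (2 * \<delta>) * (Gamma (d / 2) / Gamma ((d + 1) / 2)) * D 0"
  by (simp add: stein_derivative_bound_def)

text \<open>Passing from \<open>n\<close> to \<open>Suc n\<close> multiplies every old summand by
  the same factor, because the Pochhammer symbol gains its new factor at the lower end. The
  resulting recursion is the one that the Stein bound with parameter \<open>d - 2 * Suc n\<close>
  produces.\<close>

lemma stein_derivative_bound_Suc:
  "stein_derivative_bound d \<delta> D (Suc n) =
     sqrt pi / (2 * \<delta>) * (Gamma (d / 2 - real (Suc n)) / Gamma ((d + 1) / 2 - real (Suc n))) *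
       (D (Suc n) + real (Suc n) * (d - real (Suc n)) * stein_derivative_bound d \<delta> D n)"
proof -
  let ?c = "sqrt pi / (2 * \<delta>)"
  let ?a = "\<lambda>i. Gamma (d / 2 - real i) / Gamma ((d + 1) / 2 - real i)"
  have "stein_derivative_bound d \<delta> D (Suc n) =
    (\<Sum>j=0..n. ?c ^ (Suc n + 1 - j) * (fact (Suc n) / fact j) * pochhammer (d - real (Suc n)) (Suc n - j) * (\<Prod>i=j..Suc n. ?a i) * D j)
      + ?c * ?a (Suc n) * D (Suc n)"
    unfolding stein_derivative_bound_def by simp
  also have "(\<Sum>j=0..n. ?c ^ (Suc n + 1 - j) * (fact (Suc n) / fact j) * pochhammer (d - real (Suc n)) (Suc n - j) * (\<Prod>i=j..Suc n. ?a i) * D j)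
     = (\<Sum>j=0..n. ?c * ?a (Suc n) * (real (Suc n) * (d - real (Suc n))) * 
       (?c ^ (n + 1 - j) * (fact n / fact j) * pochhammer (d - real n) (n - j) * (\<Prod>i=j..n. ?a i) * D j))"
  proof (rule sum.cong)
    fix j assume "j \<in> {0..n}"
    then have j: "j \<le> n" by simp
    have 1: "?c ^ (Suc n + 1 - j) = ?c * ?c ^ (n + 1 - j)" using j by (simp add: Suc_diff_le)
    have 2: "pochhammer (d - real (Suc n)) (Suc n - j) = (d - real (Suc n)) * pochhammer (d - real n) (n - j)"
      using j by (simp add: Suc_diff_le pochhammer_rec)
    have 3: "(\<Prod>i=j..Suc n. ?a i) = ?a (Suc n) * (\<Prod>i=j..n. ?a i)" using j by (simp add: prod.nat_ivl_Suc' mult.commute)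
    have 4: "fact (Suc n) / fact j = real (Suc n) * (fact n / fact j :: real)" by (simp only: fact_Suc) simp
    show "?c ^ (Suc n + 1 - j) * (fact (Suc n) / fact j) * pochhammer (d - real (Suc n)) (Suc n - j) * (\<Prod>i=j..Suc n. ?a i) * D j
      = ?c * ?a (Suc n) * (real (Suc n) * (d - real (Suc n))) * 
       (?c ^ (n + 1 - j) * (fact n / fact j) * pochhammer (d - real n) (n - j) * (\<Prod>i=j..n. ?a i) * D j)"
      unfolding 1 2 3 4 by (simp only: mult_ac)
  qed simp
  also have "\<dots> = ?c * ?a (Suc n) * (real (Suc n) * (d - real (Suc n))) * stein_derivative_bound d \<delta> D n"
    unfolding stein_derivative_bound_def by (rule sum_distrib_left[symmetric])
  finally show ?thesis by (simp only: distrib_left mult.assoc add.commute)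
qed

text \<open>Here \<open>\<phi>0\<close>, \<open>\<phi>1\<close>, \<open>\<phi>2\<close> stand for
  consecutive derivatives. The weight has no zero, so \<open>\<phi>2\<close> is a quotient of
  differentiable functions and the existence of its derivative is obtained along with the equation.
  The alternative \<open>b = 0\<close> covers the first differentiation, where
  \<open>\<phi>1\<close> has no predecessor.\<close>

lemma stein_equation_differentiate:
  fixes \<delta> :: real
  assumes \<delta>: "\<delta> > 0" and eq: "\<And>y. (\<delta>\<^sup>2 + y\<^sup>2) * \<phi>2 y = a * y * \<phi>1 y + \<gamma> y + b * \<phi>0 y"
    and d1: "(\<phi>1 has_real_derivative \<phi>2 x) (at x)" and dg: "(\<gamma> has_real_derivative \<gamma>') (at x)"
    and d0: "b = 0 \<or> (\<phi>0 has_real_derivative \<phi>1 x) (at x)"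
  shows "\<exists>E. (\<phi>2 has_real_derivative E) (at x) \<and> (\<delta>\<^sup>2 + x\<^sup>2) * E = (a - 2) * x * \<phi>2 x + \<gamma>' + (a + b) * \<phi>1 x"
proof -
  have w: "\<delta>\<^sup>2 + y\<^sup>2 \<noteq> 0" for y :: real using \<delta> by (simp add: sum_power2_eq_zero_iff)
  let ?N = "\<lambda>y. a * (y * \<phi>1 y) + \<gamma> y + b * \<phi>0 y"
  let ?E = "(a * (1 * \<phi>1 x + \<phi>2 x * x) + \<gamma>' + b * \<phi>1 x - (0 + real 2 * x ^ (2 - Suc 0)) * \<phi>2 x) / (\<delta>\<^sup>2 + x\<^sup>2)"
  have \<phi>2: "\<phi>2 = (\<lambda>y. ?N y / (\<delta>\<^sup>2 + y\<^sup>2))"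
    using eq w by (auto simp: field_simps)
  have "((\<lambda>y. b * \<phi>0 y) has_real_derivative b * \<phi>1 x) (at x)"
    using d0 by (auto intro: DERIV_cmult)
  then have N: "(?N has_real_derivative a * (1 * \<phi>1 x + \<phi>2 x * x) + \<gamma>' + b * \<phi>1 x) (at x)"
    by (rule DERIV_add[OF DERIV_add[OF DERIV_cmult[OF DERIV_mult[OF DERIV_ident d1]] dg]])
  have W: "((\<lambda>y. \<delta>\<^sup>2 + y\<^sup>2) has_real_derivative 0 + real 2 * x ^ (2 - Suc 0)) (at x)"
    by (intro DERIV_add DERIV_const DERIV_pow)
  have "((\<lambda>y. ?N y / (\<delta>\<^sup>2 + y\<^sup>2)) has_real_derivative
      ((a * (1 * \<phi>1 x + \<phi>2 x * x) + \<gamma>' + b * \<phi>1 x) * (\<delta>\<^sup>2 + x\<^sup>2) - ?N x * (0 + real 2 * x ^ (2 - Suc 0))) /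
        ((\<delta>\<^sup>2 + x\<^sup>2) * (\<delta>\<^sup>2 + x\<^sup>2))) (at x)"
    by (rule DERIV_divide[OF N W w])
  also have "?N x = (\<delta>\<^sup>2 + x\<^sup>2) * \<phi>2 x" using eq[of x] by simp
  also have "((a * (1 * \<phi>1 x + \<phi>2 x * x) + \<gamma>' + b * \<phi>1 x) * (\<delta>\<^sup>2 + x\<^sup>2) - (\<delta>\<^sup>2 + x\<^sup>2) * \<phi>2 x * (0 + real 2 * x ^ (2 - Suc 0))) /
        ((\<delta>\<^sup>2 + x\<^sup>2) * (\<delta>\<^sup>2 + x\<^sup>2)) = ?E"
  proof -
    have "(A * v - v * p * q) / (v * v) = (A - q * p) / v" if "v \<noteq> 0" for A v p q :: real
      using that by (simp add: field_simps)
    then show ?thesis using w[of x] .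
  qed
  finally have "(\<phi>2 has_real_derivative ?E) (at x)" unfolding \<phi>2[symmetric] .
  moreover have "(\<delta>\<^sup>2 + x\<^sup>2) * ?E = (a - 2) * x * \<phi>2 x + \<gamma>' + (a + b) * \<phi>1 x"
    unfolding times_divide_eq_right nonzero_mult_div_cancel_left[OF w] by (simp add: algebra_simps)
  ultimately show ?thesis by blast
qed

section \<open>The differentiated Stein equations and the induction on their order\<close>

context
  fixes d \<delta> :: real and n :: nat and f :: "real \<Rightarrow> real" and \<gamma> :: "nat \<Rightarrow> real \<Rightarrow> real" and D :: "nat \<Rightarrow> real"
  assumes \<delta>: "\<delta> > 0" and d: "d - 2 * real n > 0"
    and tail: "\<And>k. k \<le> n \<Longrightarrow> \<exists>W. stein_weight_tail \<delta> (d - 2 * real k) W"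
    and \<gamma>_deriv: "\<And>k x. Suc k < n \<Longrightarrow> (\<gamma> k has_real_derivative \<gamma> (Suc k) x) (at x)"
    and \<gamma>_lip: "n \<ge> 1 \<Longrightarrow> locally_lipschitz (\<gamma> (n - 1))"
    and \<gamma>_AE: "n \<ge> 1 \<Longrightarrow> AE x in lborel. (\<gamma> (n - 1) has_real_derivative \<gamma> n x) (at x)"
    and D_nonneg: "\<And>k. k \<le> n \<Longrightarrow> D k \<ge> 0"
    and \<gamma>_bound: "\<And>k x. k < n \<Longrightarrow> \<bar>\<gamma> k x\<bar> \<le> D k"
    and \<gamma>_bound_AE: "AE x in lborel. \<bar>\<gamma> n x\<bar> \<le> D n"
    and f_lip: "locally_lipschitz f"
    and f_AE: "AE x in lborel. \<exists>E. (f has_real_derivative E) (at x) \<and> (\<delta>\<^sup>2 + x\<^sup>2) * E = (d - 1) * x * f x + \<gamma> 0 x"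
    and f_all: "\<And>x. n \<ge> 1 \<Longrightarrow> \<exists>E. (f has_real_derivative E) (at x) \<and> (\<delta>\<^sup>2 + x\<^sup>2) * E = (d - 1) * x * f x + \<gamma> 0 x"
    and f_bot: "((\<lambda>x. (\<delta>\<^sup>2 + x\<^sup>2) powr (- (d - 1) / 2) * f x) \<longlongrightarrow> 0) at_bot"
    and f_top: "((\<lambda>x. (\<delta>\<^sup>2 + x\<^sup>2) powr (- (d - 1) / 2) * f x) \<longlongrightarrow> 0) at_top"
begin

text \<open>Each order differentiates the equation of the order before. At \<open>k = 0\<close>
  truncated subtraction makes \<open>k - 1\<close> equal to 0, harmlessly, since the coefficient
  \<open>real k\<close> vanishes.\<close>

lemma stein_derivatives:
  assumes "k < n"
  shows "((deriv ^^ k) f has_real_derivative (deriv ^^ Suc k) f x) (at x) \<and>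
     (\<delta>\<^sup>2 + x\<^sup>2) * (deriv ^^ Suc k) f x =
       (d - 2 * real k - 1) * x * (deriv ^^ k) f x + \<gamma> k x + real k * (d - real k) * (deriv ^^ (k - 1)) f x"
  using assms
proof (induction k arbitrary: x rule: less_induct)
  case (less k)
  show ?case
  proof (cases k)
    case 0
    then obtain E where E: "(f has_real_derivative E) (at x)" "(\<delta>\<^sup>2 + x\<^sup>2) * E = (d - 1) * x * f x + \<gamma> 0 x"
      using f_all[of x] less.prems by auto
    then show ?thesis using DERIV_imp_deriv[OF E(1)] 0 by simp
  next
    case (Suc m)
    have "(\<delta>\<^sup>2 + y\<^sup>2) * (deriv ^^ k) f y =
      (d - 2 * real m - 1) * y * (deriv ^^ m) f y + \<gamma> m y + real m * (d - real m) * (deriv ^^ (m - 1)) f y" for y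
      using less.IH[of m y] less.prems Suc by auto
    moreover have "((deriv ^^ m) f has_real_derivative (deriv ^^ k) f x) (at x)"
      using less.IH[of m x] less.prems Suc by auto
    moreover have "(\<gamma> m has_real_derivative \<gamma> k x) (at x)" using \<gamma>_deriv[of m x] less.prems Suc by auto
    moreover have "real m * (d - real m) = 0 \<or> ((deriv ^^ (m - 1)) f has_real_derivative (deriv ^^ m) f x) (at x)"
      using less.IH[of "m - 1" x] less.prems Suc by (cases m) auto
    ultimately obtain E where E: "((deriv ^^ k) f has_real_derivative E) (at x)"
       "(\<delta>\<^sup>2 + x\<^sup>2) * E = (d - 2 * real m - 1 - 2) * x * (deriv ^^ k) f x + \<gamma> k x + (d - 2 * real m - 1 + real m * (d - real m)) * (deriv ^^ m) f x"
      using stein_equation_differentiate[OF \<delta>] by blast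
    have "(deriv ^^ Suc k) f x = E" using DERIV_imp_deriv[OF E(1)] by simp
    moreover have "d - 2 * real m - 1 - 2 = d - 2 * real k - 1" "m = k - 1"
      \<comment> \<open>The coefficient rule \<open>a + b\<close> of one differentiation reproduces
        the pattern \<open>k * (d - k)\<close>.\<close>
      "d - 2 * real m - 1 + real m * (d - real m) = real k * (d - real k)"
      using Suc by (auto simp: algebra_simps)
    ultimately show ?thesis using E by metis
  qed
qed

text \<open>At the top order the data \<open>\<gamma> (n - 1)\<close> are differentiable only almost
  everywhere, so the last differentiation is done outside a null set; below it the equation holds at
  every point.\<close>

lemma stein_derivative_equation_AE:
  assumes "k \<le> n"
  shows "AE x in lborel. \<exists>E. ((deriv ^^ k) f has_real_derivative E) (at x) \<and>
     (\<delta>\<^sup>2 + x\<^sup>2) * E = (d - 2 * real k - 1) * x * (deriv ^^ k) f x + \<gamma> k x + real k * (d - real k) * (deriv ^^ (k - 1)) f x"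
proof (cases "k < n")
  case True
  then show ?thesis using stein_derivatives[OF True] by (intro AE_I2) blast
next
  case False
  then have k: "k = n" using assms by simp
  show ?thesis
  proof (cases k)
    case 0
    then show ?thesis using f_AE by simp
  next
    case (Suc m)
    have "AE x in lborel. (\<gamma> m has_real_derivative \<gamma> k x) (at x)" using \<gamma>_AE k Suc by (metis diff_Suc_1 le_add1 plus_1_eq_Suc)
    then show ?thesis
    proof eventually_elim
      case (elim x)
      have m: "m < n" "\<And>y. m - 1 < n" using k Suc by auto
      have "(\<delta>\<^sup>2 + y\<^sup>2) * (deriv ^^ k) f y =
        (d - 2 * real m - 1) * y * (deriv ^^ m) f y + \<gamma> m y + real m * (d - real m) * (deriv ^^ (m - 1)) f y" for y
        using stein_derivatives[OF m(1), of y] Suc by auto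
      moreover have "((deriv ^^ m) f has_real_derivative (deriv ^^ k) f x) (at x)"
        using stein_derivatives[OF m(1), of x] Suc by auto
      moreover have "real m * (d - real m) = 0 \<or> ((deriv ^^ (m - 1)) f has_real_derivative (deriv ^^ m) f x) (at x)"
        using stein_derivatives[OF m(2), of x] by (cases m) auto
      ultimately obtain E where E: "((deriv ^^ k) f has_real_derivative E) (at x)"
         "(\<delta>\<^sup>2 + x\<^sup>2) * E = (d - 2 * real m - 1 - 2) * x * (deriv ^^ k) f x + \<gamma> k x + (d - 2 * real m - 1 + real m * (d - real m)) * (deriv ^^ m) f x"
        using stein_equation_differentiate[OF \<delta> _ _ elim] by blast
      moreover have "d - 2 * real m - 1 - 2 = d - 2 * real k - 1" "m = k - 1"
        "d - 2 * real m - 1 + real m * (d - real m) = real k * (d - real k)"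
        using Suc by (auto simp: algebra_simps)
      ultimately show ?case by metis
    qed
  qed
qed

lemma stein_data_lipschitz:
  assumes "k < n" shows "locally_lipschitz (\<gamma> k)"
proof (cases "Suc k = n")
  case True then show ?thesis using \<gamma>_lip by auto
next
  case False
  then have k: "Suc k < n" using assms by simp
  have "continuous_on UNIV (\<gamma> (Suc k))"
  proof (cases "Suc (Suc k) = n")
    case True then show ?thesis using \<gamma>_lip locally_lipschitz_continuous by force
  next
    case False
    then have "Suc (Suc k) < n" using k by simp
    then show ?thesis by (meson \<gamma>_deriv DERIV_continuous continuous_at_imp_continuous_on)
  qed
  then show ?thesis using locally_lipschitz_C1 \<gamma>_deriv[OF k] by blast
qed

text \<open>The equation one order below, solved for its highest derivative, expresses it by sums
  and products of locally Lipschitz functions.\<close>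

lemma stein_derivative_lipschitz:
  assumes "k \<le> n" shows "locally_lipschitz ((deriv ^^ k) f)"
  using assms
proof (induction k rule: less_induct)
  case (less k)
  show ?case
  proof (cases k)
    case 0 then show ?thesis using f_lip by simp
  next
    case (Suc m)
    have m: "m < n" using less.prems Suc by simp
    have w: "\<delta>\<^sup>2 + y\<^sup>2 > 0" for y :: real using \<delta> by (simp add: add_pos_nonneg)
    \<comment> \<open>The exponent \<open>- (3 - 1) / 2\<close> is \<open>- 1\<close>, in the shape
      of the derivative rule with parameter 3.\<close>
    have "(deriv ^^ k) f = (\<lambda>x. (\<delta>\<^sup>2 + x\<^sup>2) powr (- (3 - 1) / 2) *
       ((d - 2 * real m - 1) * x * (deriv ^^ m) f x + \<gamma> m x + real m * (d - real m) * (deriv ^^ (m - 1)) f x))"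
    proof
      fix x
      have "(\<delta>\<^sup>2 + x\<^sup>2) powr (- (3 - 1) / 2) * (\<delta>\<^sup>2 + x\<^sup>2) = 1"
        using less_imp_neq[OF w[of x]] \<delta> by (simp add: powr_minus)
      then show "(deriv ^^ k) f x = (\<delta>\<^sup>2 + x\<^sup>2) powr (- (3 - 1) / 2) *
       ((d - 2 * real m - 1) * x * (deriv ^^ m) f x + \<gamma> m x + real m * (d - real m) * (deriv ^^ (m - 1)) f x)"
        using stein_derivatives[OF m, of x] Suc by (metis mult.assoc mult_1)
    qed
    moreover have "locally_lipschitz (\<lambda>x. (\<delta>\<^sup>2 + x\<^sup>2) powr (- (3 - 1) / 2))"
      by (rule locally_lipschitz_C1[OF weight_powr_deriv[OF \<delta>]])
         (intro continuous_on_mult continuous_on_const continuous_on_id weight_powr_continuous[OF \<delta>])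
    moreover have "locally_lipschitz ((deriv ^^ m) f)" "locally_lipschitz ((deriv ^^ (m - 1)) f)"
      using less.IH[of m] less.IH[of "m - 1"] Suc m by auto
    ultimately show ?thesis
      by (simp only:) (intro locally_lipschitz_mult locally_lipschitz_add locally_lipschitz_const
          locally_lipschitz_ident stein_data_lipschitz[OF m])
  qed
qed

text \<open>The second conjunct is carried along because, one order up, it supplies the boundary
  limits without which the comparison argument cannot start.\<close>

lemma stein_derivative_bounds:
  assumes "k \<le> n"
  shows "(\<forall>x. \<bar>(deriv ^^ k) f x\<bar> \<le> stein_derivative_bound d \<delta> D k) \<and> (\<exists>C. \<forall>x. \<bar>x * (deriv ^^ k) f x\<bar> \<le> C)"
  using assms
proof (induction k rule: less_induct)
  case (less k)
  note k = less.prems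
  \<comment> \<open>\<open>S\<close> bounds the derivative of the order before; the value 0 at
    \<open>k = 0\<close> is a placeholder that is multiplied by \<open>real k\<close>.\<close>
  define S where "S = (if k = 0 then 0 else stein_derivative_bound d \<delta> D (k - 1))"
  define dk where "dk = d - 2 * real k"
  have dk: "dk > 0" and dk': "d - real k \<ge> 0" using d k by (auto simp: dk_def)
  obtain W where W: "stein_weight_tail \<delta> dk W" using tail[OF k] by (auto simp: dk_def)
  define R where "R = D k + real k * (d - real k) * S"
  have S: "k > 0 \<Longrightarrow> \<bar>(deriv ^^ (k - 1)) f x\<bar> \<le> S" for x
    using less.IH[of "k - 1"] k by (auto simp: S_def)
  have S0: "S \<ge> 0"
    using S[of 0] by (cases "k = 0") (auto simp: S_def)
  have R: "R \<ge> 0" unfolding R_def by (intro add_nonneg_nonneg mult_nonneg_nonneg D_nonneg k S0 dk') auto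
  have bAE: "AE x in lborel. \<bar>\<gamma> k x\<bar> \<le> D k"
    using \<gamma>_bound_AE \<gamma>_bound k by (cases "k = n") (auto intro: AE_I2)
  have eq: "AE x in lborel. \<exists>E. ((deriv ^^ k) f has_real_derivative E) (at x) \<and>
     \<bar>(\<delta>\<^sup>2 + x\<^sup>2) * E - (dk - 1) * x * (deriv ^^ k) f x\<bar> \<le> R"
    using stein_derivative_equation_AE[OF k] bAE
  proof eventually_elim
    case (elim x)
    then obtain E where E: "((deriv ^^ k) f has_real_derivative E) (at x)"
       "(\<delta>\<^sup>2 + x\<^sup>2) * E = (dk - 1) * x * (deriv ^^ k) f x + \<gamma> k x + real k * (d - real k) * (deriv ^^ (k - 1)) f x"
      by (auto simp: dk_def)
    have "\<bar>real k * (d - real k) * (deriv ^^ (k - 1)) f x\<bar> \<le> real k * (d - real k) * S"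
      using S[of x] dk' by (cases "k = 0") (auto simp: abs_mult intro!: mult_left_mono)
    then have "\<bar>\<gamma> k x + real k * (d - real k) * (deriv ^^ (k - 1)) f x\<bar> \<le> R"
      using elim(2) unfolding R_def by linarith
    then show ?case using E by auto
  qed
  have lim: "((\<lambda>x. (\<delta>\<^sup>2 + x\<^sup>2) powr (- (dk - 1) / 2) * (deriv ^^ k) f x) \<longlongrightarrow> 0) F"
    if F: "F = at_bot \<or> F = at_top" for F
  proof (cases k)
    case 0
    then show ?thesis using f_bot f_top F by (auto simp: dk_def)
  next
    case (Suc m)
    have m: "m < k" "m < n" "m - 1 < k" using Suc k by auto
    obtain C where C: "\<And>x. \<bar>x * (deriv ^^ m) f x\<bar> \<le> C" using less.IH[OF m(1)] m by auto
    \<comment> \<open>The three terms on the right of the equation of order \<open>m\<close>,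
      bounded one by one; the first uses that \<open>x\<close> times the derivative of order
      \<open>m\<close> is bounded.\<close>
    let ?Y = "\<bar>d - 2 * real m - 1\<bar> * C + D m + \<bar>real m * (d - real m)\<bar> * stein_derivative_bound d \<delta> D (m - 1)"
    have Y: "\<bar>(\<delta>\<^sup>2 + x\<^sup>2) * (deriv ^^ k) f x\<bar> \<le> ?Y" for x
    proof -
      have e: "(\<delta>\<^sup>2 + x\<^sup>2) * (deriv ^^ k) f x = (d - 2 * real m - 1) * (x * (deriv ^^ m) f x) + \<gamma> m x + real m * (d - real m) * (deriv ^^ (m - 1)) f x"
        using stein_derivatives[OF m(2), of x] Suc by simp
      have 1: "\<bar>(d - 2 * real m - 1) * (x * (deriv ^^ m) f x)\<bar> \<le> \<bar>d - 2 * real m - 1\<bar> * C"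
        unfolding abs_mult[of "d - 2 * real m - 1"] by (intro mult_left_mono C) auto
      have 2: "\<bar>real m * (d - real m) * (deriv ^^ (m - 1)) f x\<bar> \<le> \<bar>real m * (d - real m)\<bar> * stein_derivative_bound d \<delta> D (m - 1)"
        unfolding abs_mult[of "real m * (d - real m)"] using less.IH[OF m(3)] m by (intro mult_left_mono) auto
      show ?thesis unfolding e using 1 2 \<gamma>_bound[OF m(2), of x] by linarith
    qed
    show ?thesis
    proof (rule Lim_null_comparison)
      show "\<forall>\<^sub>F x in F. norm ((\<delta>\<^sup>2 + x\<^sup>2) powr (- (dk - 1) / 2) * (deriv ^^ k) f x) \<le> ?Y * (\<delta>\<^sup>2 + x\<^sup>2) powr (- (dk + 1) / 2)"
      proof (intro always_eventually allI)
        fix x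
        have "norm ((\<delta>\<^sup>2 + x\<^sup>2) powr (- (dk - 1) / 2) * (deriv ^^ k) f x) =
           \<bar>(\<delta>\<^sup>2 + x\<^sup>2) * (deriv ^^ k) f x\<bar> * (\<delta>\<^sup>2 + x\<^sup>2) powr (- (dk + 1) / 2)"
          unfolding weight_powr_split(1)[OF \<delta>] by (simp add: abs_mult mult_ac)
        also have "\<dots> \<le> ?Y * (\<delta>\<^sup>2 + x\<^sup>2) powr (- (dk + 1) / 2)" by (intro mult_right_mono Y) auto
        finally show "norm ((\<delta>\<^sup>2 + x\<^sup>2) powr (- (dk - 1) / 2) * (deriv ^^ k) f x) \<le> ?Y * (\<delta>\<^sup>2 + x\<^sup>2) powr (- (dk + 1) / 2)" .
      qed
      have "((\<lambda>x. (\<delta>\<^sup>2 + x\<^sup>2) powr (- (dk + 1) / 2)) \<longlongrightarrow> 0) at_bot" using dk \<delta> by real_asymp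
      moreover have "((\<lambda>x. (\<delta>\<^sup>2 + x\<^sup>2) powr (- (dk + 1) / 2)) \<longlongrightarrow> 0) at_top" using dk \<delta> by real_asymp
      ultimately show "((\<lambda>x. ?Y * (\<delta>\<^sup>2 + x\<^sup>2) powr (- (dk + 1) / 2)) \<longlongrightarrow> 0) F"
        using F by (intro tendsto_mult_right_zero) auto
    qed
  qed
  note lip = stein_derivative_lipschitz[OF k]
  have "stein_derivative_bound d \<delta> D k = sqrt pi / (2 * \<delta>) * (Gamma (dk / 2) / Gamma ((dk + 1) / 2)) * R"
  proof (cases k)
    case 0
    then show ?thesis by (simp add: R_def dk_def stein_derivative_bound_0)
  next
    case (Suc m)
    \<comment> \<open>Lowering \<open>d\<close> by \<open>2 * k\<close> shifts both Gamma arguments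
      by \<open>k\<close>, which matches the product in the bound.\<close>
    have e: "d / 2 - real k = dk / 2" "(d + 1) / 2 - real k = (dk + 1) / 2" by (auto simp: dk_def field_simps)
    show ?thesis
      using stein_derivative_bound_Suc[of d \<delta> D m] unfolding Suc[symmetric] e R_def S_def by (simp add: Suc)
  qed
  then show ?case
    using stein_equation_bound[OF W \<delta> dk R lip eq lim lim] by auto
qed

end

section \<open>The class of the test function\<close>

lemma deriv_dom_Suc_subset: "deriv_dom (Suc j) g \<subseteq> deriv_dom j g"
  by (auto dest: eventually_nhds_x_imp_x)

lemma deriv_dom_antimono: "j \<le> k \<Longrightarrow> deriv_dom k g \<subseteq> deriv_dom j g"
  using lift_Suc_antimono_le[of "\<lambda>j. deriv_dom j g"] deriv_dom_Suc_subset by blast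

lemma deriv_dom_Suc_has_real_derivative:
  assumes "x \<in> deriv_dom (Suc j) g"
  shows "((deriv ^^ j) g has_real_derivative (deriv ^^ Suc j) g x) (at x)"
  using assms by (simp add: DERIV_deriv_iff_real_differentiable)

lemma deriv_dom_eq_UNIV:
  assumes "\<And>j x. j < k \<Longrightarrow> (deriv ^^ j) g differentiable (at x)"
  shows "deriv_dom k g = UNIV"
  using assms by (induction k) auto

text \<open>Valid even where no derivative exists: \<open>deriv\<close> depends only on which
  numbers are derivatives at the point, and subtracting a constant does not change these.\<close>

lemma deriv_pow_diff_const:
  "(deriv ^^ k) (\<lambda>x. g x - c) = (\<lambda>x::real. (deriv ^^ k) g x - (if k = 0 then c else 0))"
proof (cases k)
  case (Suc m)
  have "deriv (\<lambda>x. g x - c) = deriv g"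
  proof
    fix x
    have "((\<lambda>x. g x - c) has_field_derivative D) (at x) \<longleftrightarrow> (g has_field_derivative D) (at x)" for D
      using DERIV_diff[of g D x UNIV "\<lambda>_. c" 0] DERIV_add[of "\<lambda>x. g x - c" D x UNIV "\<lambda>_. c" 0] by auto
    then show "deriv (\<lambda>x. g x - c) x = deriv g x" by (simp add: deriv_def)
  qed
  then show ?thesis by (simp add: Suc funpow_swap1)
qed simp

section \<open>From absolute continuity with bounded derivative to Lipschitz continuity\<close>

lemma abs_cont_on_linear_add:
  assumes g: "abs_cont_on a b g" and s: "\<bar>s\<bar> = 1" and c: "c \<ge> 0"
  shows "abs_cont_on a b (\<lambda>x. c * x + s * g x)"
  unfolding abs_cont_on_def
proof (intro allI impI)
  fix e :: real assume e: "e > 0"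
  obtain \<eta> where \<eta>: "\<eta> > 0" and I: "\<And>I. finite I \<Longrightarrow> 
        (\<forall>(u, v)\<in>I. a \<le> u \<and> u < v \<and> v \<le> b) \<Longrightarrow>
        pairwise (\<lambda>(u, v) (u', v'). disjnt {u<..<v} {u'<..<v'}) I \<Longrightarrow>
        (\<Sum>(u, v)\<in>I. v - u) < \<eta> \<Longrightarrow>
        (\<Sum>(u, v)\<in>I. \<bar>g v - g u\<bar>) < e / 2"
    using g[unfolded abs_cont_on_def, rule_format, of "e / 2"] e by force
  define \<eta>' where "\<eta>' = min \<eta> (e / (2 * (c + 1)))"
  have "\<eta>' > 0" using \<eta> e c by (simp add: \<eta>'_def)
  moreover have "(\<Sum>(u, v)\<in>I. \<bar>(c * v + s * g v) - (c * u + s * g u)\<bar>) < e"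
    if fin: "finite I" and uv: "\<forall>(u, v)\<in>I. a \<le> u \<and> u < v \<and> v \<le> b"
      and disj: "pairwise (\<lambda>(u, v) (u', v'). disjnt {u<..<v} {u'<..<v'}) I"
      and small: "(\<Sum>(u, v)\<in>I. v - u) < \<eta>'" for I
  proof -
    have "(\<Sum>(u, v)\<in>I. \<bar>(c * v + s * g v) - (c * u + s * g u)\<bar>) \<le> (\<Sum>(u, v)\<in>I. c * (v - u) + \<bar>g v - g u\<bar>)"
    proof (rule sum_mono, clarify)
      fix u v assume "(u, v) \<in> I"
      then have "u < v" using uv by auto
      have "(c * v + s * g v) - (c * u + s * g u) = c * (v - u) + s * (g v - g u)" by (simp add: algebra_simps)
      also have "\<bar>\<dots>\<bar> \<le> c * (v - u) + \<bar>g v - g u\<bar>"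
        using abs_triangle_ineq[of "c * (v - u)" "s * (g v - g u)"] c s \<open>u < v\<close> by (simp add: abs_mult)
      finally show "\<bar>(c * v + s * g v) - (c * u + s * g u)\<bar> \<le> c * (v - u) + \<bar>g v - g u\<bar>" .
    qed
    also have "\<dots> = c * (\<Sum>(u, v)\<in>I. v - u) + (\<Sum>(u, v)\<in>I. \<bar>g v - g u\<bar>)"
      by (simp add: sum.distrib sum_distrib_left case_prod_unfold)
    also have "c * (\<Sum>(u, v)\<in>I. v - u) \<le> (c + 1) * (\<Sum>(u, v)\<in>I. v - u)"
      using uv by (intro mult_right_mono sum_nonneg) auto
    also have "(c + 1) * (\<Sum>(u, v)\<in>I. v - u) \<le> (c + 1) * (e / (2 * (c + 1)))"
      using small c by (intro mult_left_mono) (auto simp: \<eta>'_def)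
    also have "(c + 1) * (e / (2 * (c + 1))) = e / 2" using c by (simp add: field_simps)
    also have "(\<Sum>(u, v)\<in>I. \<bar>g v - g u\<bar>) < e / 2"
      using small by (intro I fin uv disj) (simp add: \<eta>'_def)
    finally show ?thesis by simp
  qed
  ultimately show "\<exists>\<eta>>0. \<forall>I :: (real \<times> real) set. finite I \<longrightarrow>
        (\<forall>(u, v)\<in>I. a \<le> u \<and> u < v \<and> v \<le> b) \<longrightarrow>
        pairwise (\<lambda>(u, v) (u', v'). disjnt {u<..<v} {u'<..<v'}) I \<longrightarrow>
        (\<Sum>(u, v)\<in>I. v - u) < \<eta> \<longrightarrow> (\<Sum>(u, v)\<in>I. \<bar>(c * v + s * g v) - (c * u + s * g u)\<bar>) < e"
    by blast
qed

text \<open>Both \<open>B * x + g x\<close> and \<open>B * x - g x\<close> are absolutely continuous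
  with almost everywhere nonnegative derivative, hence nondecreasing; together this says that
  \<open>g\<close> has Lipschitz constant \<open>B\<close>.\<close>

lemma abs_cont_on_bounded_deriv_imp_locally_lipschitz:
  assumes g: "\<And>a b. abs_cont_on a b g" and B: "B \<ge> 0"
    and AE: "AE x in lborel. \<exists>D. (g has_real_derivative D) (at x) \<and> \<bar>D\<bar> \<le> B"
  shows "locally_lipschitz g"
  unfolding locally_lipschitz_def
proof (intro allI)
  fix a b :: real
  obtain N where N: "negligible N" "\<And>x. x \<notin> N \<Longrightarrow> \<exists>D. (g has_real_derivative D) (at x) \<and> \<bar>D\<bar> \<le> B"
    using AE_lborel_negligibleE[OF AE] by blast
  have le: "B * x + s * g x \<le> B * y + s * g y" if xy: "x \<le> y" and s: "\<bar>s\<bar> = 1" for x y s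
  proof (rule abs_cont_on_deriv_nonneg_imp_le[OF xy abs_cont_on_linear_add[OF g s B] N(1)])
    fix z assume "z \<in> {x..y} - N"
    then obtain D where D: "(g has_real_derivative D) (at z)" "\<bar>D\<bar> \<le> B" using N(2) by blast
    have "((\<lambda>x. B * x + s * g x) has_real_derivative B * 1 + s * D) (at z)"
      by (rule DERIV_add[OF DERIV_cmult[OF DERIV_ident] DERIV_cmult[OF D(1)]])
    moreover have "\<bar>s * D\<bar> \<le> B" using D(2) s by (simp add: abs_mult)
    then have "B * 1 + s * D \<ge> 0" by linarith
    ultimately show "\<exists>D\<ge>0. ((\<lambda>x. B * x + s * g x) has_real_derivative D) (at z)" by blast
  qed
  have "B-lipschitz_on {a..b} g"
  proof (rule lipschitz_on_leI[OF _ B])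
    fix x y :: real assume "x \<le> y"
    then show "dist (g x) (g y) \<le> B * dist x y"
      using le[of x y 1] le[of x y "-1"] by (simp add: dist_real_def algebra_simps abs_le_iff)
  qed
  then show "\<exists>L. L-lipschitz_on {a..b} g" ..
qed

lemma AE_lborel_ex: "AE x in (lborel :: real measure). P x \<Longrightarrow> \<exists>x. P x"
proof (rule ccontr)
  assume "AE x in (lborel :: real measure). P x" "\<nexists>x. P x"
  then have "AE x in (lborel :: real measure). False" by simp
  then have "emeasure (lborel :: real measure) UNIV = 0"
    using AE_iff_measurable[of UNIV "lborel :: real measure" "\<lambda>_. False"] by simp
  then show False by simp
qed

lemma abs_le_deriv_norm:
  assumes "bounded ((deriv ^^ j) g ` deriv_dom j g)" "x \<in> deriv_dom j g"
  shows "\<bar>(deriv ^^ j) g x\<bar> \<le> deriv_norm j g"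
proof -
  obtain B where "\<And>y. y \<in> deriv_dom j g \<Longrightarrow> \<bar>(deriv ^^ j) g y\<bar> \<le> B"
    using assms(1) by (auto simp: bounded_iff)
  then show ?thesis unfolding deriv_norm_def
    using assms(2) by (intro cSUP_upper bdd_aboveI2[of _ _ B]) auto
qed

text \<open>The product rule at a single point, so that it serves both the almost everywhere
  statement and, for continuous data, the statement at all points.\<close>

lemma stein_solution_deriv:
  assumes \<delta>: "\<delta> > 0"
    and P: "((\<lambda>x. LINT t:{..x}|lborel. (\<delta>\<^sup>2 + t\<^sup>2) powr (- (d + 1) / 2) * g t) has_real_derivative
      (\<delta>\<^sup>2 + x\<^sup>2) powr (- (d + 1) / 2) * g x) (at x)"
  shows "\<exists>E. (stein_solution d \<delta> g has_real_derivative E) (at x) \<and>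
    (\<delta>\<^sup>2 + x\<^sup>2) * E = (d - 1) * x * stein_solution d \<delta> g x + g x"
proof -
  let ?P = "\<lambda>x. LINT t:{..x}|lborel. (\<delta>\<^sup>2 + t\<^sup>2) powr (- (d + 1) / 2) * g t"
  let ?u = "(\<delta>\<^sup>2 + x\<^sup>2) powr (- (d + 1) / 2)"
  define v where "v = (\<delta>\<^sup>2 + x\<^sup>2) powr (- ((2 - d) + 1) / 2)"
  have dw: "((\<lambda>x. (\<delta>\<^sup>2 + x\<^sup>2) powr ((d - 1) / 2)) has_real_derivative (d - 1) * x * v) (at x)"
    using weight_powr_deriv[OF \<delta>, of "2 - d" x] unfolding v_def by (simp add: algebra_simps)
  have v: "(\<delta>\<^sup>2 + x\<^sup>2) powr ((d - 1) / 2) = (\<delta>\<^sup>2 + x\<^sup>2) * v"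
    using weight_powr_split(1)[OF \<delta>, of x "2 - d"] unfolding v_def by simp
  have wu: "(\<delta>\<^sup>2 + x\<^sup>2) powr ((d - 1) / 2) * ((\<delta>\<^sup>2 + x\<^sup>2) * ?u) = 1"
    using weight_powr_split(2)[OF \<delta>, of x d] unfolding weight_powr_split(1)[OF \<delta>] .
  have "((\<lambda>x. (\<delta>\<^sup>2 + x\<^sup>2) powr ((d - 1) / 2) * ?P x) has_real_derivative
     (d - 1) * x * v * ?P x + ?u * g x * (\<delta>\<^sup>2 + x\<^sup>2) powr ((d - 1) / 2)) (at x)"
    by (rule DERIV_mult[OF dw P])
  moreover have "(\<lambda>x. (\<delta>\<^sup>2 + x\<^sup>2) powr ((d - 1) / 2) * ?P x) = stein_solution d \<delta> g"
    by (simp add: stein_solution_def fun_eq_iff)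
  moreover have "(\<delta>\<^sup>2 + x\<^sup>2) * ((d - 1) * x * v * ?P x + ?u * g x * (\<delta>\<^sup>2 + x\<^sup>2) powr ((d - 1) / 2)) =
     (d - 1) * x * (((\<delta>\<^sup>2 + x\<^sup>2) * v) * ?P x) + ((\<delta>\<^sup>2 + x\<^sup>2) powr ((d - 1) / 2) * ((\<delta>\<^sup>2 + x\<^sup>2) * ?u)) * g x"
  proof -
    have "w * (a * x * v * p + u * y * q) = a * x * ((w * v) * p) + (q * (w * u)) * y" for w a x v p u y q :: real
      by (simp add: algebra_simps)
    then show ?thesis .
  qed
  ultimately show ?thesis unfolding wu v[symmetric] by (auto simp: stein_solution_def)
qed

theorem mainTheorem7:
  fixes d \<delta> :: real
    and n :: nat
    and M :: "'a measure"
    and Z :: "'a \<Rightarrow> real"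
    and h htilde f :: "real \<Rightarrow> real"
  assumes "d > 0" and "\<delta> > 0"
    and "prob_space M"
    and "distributed M lborel Z (\<lambda>x. ennreal (student_t_density d \<delta> x))"
    and "d - 2 * real n > 0"
    and "h \<in> borel_measurable borel"
    and "Cb n h"
    and "htilde = (\<lambda>x. h x - prob_space.expectation M (\<lambda>\<omega>. h (Z \<omega>)))"
    and "f = stein_solution d \<delta> htilde"
  shows "(AE x in lborel. solves_stein_at d \<delta> htilde f x) \<and>
         (n \<ge> 1 \<longrightarrow> (\<forall>x. solves_stein_at d \<delta> htilde f x)) \<and>
         deriv_dom n f = UNIV \<and>
         bounded (range ((deriv ^^ n) f)) \<and>
         deriv_norm n f \<le>
           (\<Sum>j=0..n. (sqrt pi / (2 * \<delta>)) ^ (n + 1 - j) * (fact n / fact j) *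
              pochhammer (d - real n) (n - j) *
              (\<Prod>i=j..n. Gamma (d / 2 - real i) / Gamma ((d + 1) / 2 - real i)) *
              deriv_norm j (if j = 0 then htilde else h))"
proof -
  note d = \<open>d > 0\<close> and \<delta> = \<open>\<delta> > 0\<close> and M = \<open>prob_space M\<close> and Z = assms(4)
  define E where "E = prob_space.expectation M (\<lambda>\<omega>. h (Z \<omega>))"
  have ht: "htilde = (\<lambda>x. h x - E)" using assms(8) by (simp add: E_def)
  define \<gamma> where "\<gamma> = (\<lambda>k. (deriv ^^ k) htilde)"
  define D where "D = (\<lambda>j. deriv_norm j (if j = 0 then htilde else h))"
  let ?u = "\<lambda>x. (\<delta>\<^sup>2 + x\<^sup>2) powr (- (d + 1) / 2)"
  define P where "P = (\<lambda>x. LINT t:{..x}|lborel. ?u t * htilde t)"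
  have \<gamma>: "\<gamma> k x = (deriv ^^ k) h x - (if k = 0 then E else 0)" for k x
    unfolding \<gamma>_def ht deriv_pow_diff_const ..
  have \<gamma>0: "\<gamma> 0 = htilde" by (simp add: \<gamma>_def)

  have dom: "deriv_dom j h = UNIV" if "j < n" for j
  proof -
    have "j \<le> n - 1" "deriv_dom (n - 1) h = UNIV" using \<open>Cb n h\<close> that by (auto simp: Cb_def)
    then show ?thesis using deriv_dom_antimono[of j "n - 1" h] by blast
  qed
  have domAE: "AE x in lborel. x \<in> deriv_dom n h" using \<open>Cb n h\<close> by (simp add: Cb_def)
  have bdd: "bounded ((deriv ^^ j) h ` deriv_dom j h)" if "j \<le> n" for j
    using \<open>Cb n h\<close> that by (simp add: Cb_def)
  have bh: "bounded (range h)" using bdd[of 0] by simp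
  then obtain H where H: "\<And>x. \<bar>h x\<bar> \<le> H" by (auto simp: bounded_iff)
  have Ht: "\<bar>htilde x\<bar> \<le> H + \<bar>E\<bar>" for x using H[of x] unfolding ht by linarith
  then have bht: "bounded (range htilde)" by (auto simp: bounded_iff)
  have \<gamma>D: "\<bar>\<gamma> j x\<bar> \<le> D j" if "j \<le> n" "x \<in> deriv_dom j h" for j x
  proof (cases "j = 0")
    case True
    then show ?thesis using abs_le_deriv_norm[of 0 htilde x] bht by (simp add: D_def \<gamma>0)
  next
    case False
    then show ?thesis using abs_le_deriv_norm[OF bdd[OF that(1)] that(2)] by (simp add: D_def \<gamma>)
  qed
  have \<gamma>_AE_bound: "AE x in lborel. \<bar>\<gamma> n x\<bar> \<le> D n" using domAE by eventually_elim (rule \<gamma>D, auto)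
  have Dk: "\<bar>\<gamma> k x\<bar> \<le> D k" if "k < n" for k x using \<gamma>D[of k x] dom[OF that] that by auto
  have D0: "D k \<ge> 0" if "k \<le> n" for k
  \<comment> \<open>At the top order the bound is known only almost everywhere, but a single point
    at which it holds gives the sign of \<open>D n\<close>.\<close>
  proof (cases "k = n")
    case True
    then show ?thesis using AE_lborel_ex[OF \<gamma>_AE_bound] by (metis abs_ge_zero order.trans)
  next
    case False
    then show ?thesis using Dk[of k 0] that by (metis abs_ge_zero le_neq_implies_less order.trans)
  qed
  have \<gamma>_hd: "(\<gamma> k has_real_derivative \<gamma> (Suc k) x) (at x)" if "x \<in> deriv_dom (Suc k) h" for k x
  proof -
    have "((\<lambda>x. (deriv ^^ k) h x - (if k = 0 then E else 0)) has_real_derivative (deriv ^^ Suc k) h x - 0) (at x)"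
      by (rule DERIV_diff[OF deriv_dom_Suc_has_real_derivative[OF that] DERIV_const])
    moreover have "\<gamma> k = (\<lambda>x. (deriv ^^ k) h x - (if k = 0 then E else 0))" by (rule ext) (rule \<gamma>)
    ultimately show ?thesis by (simp only: \<gamma> diff_zero nat.distinct if_False)
  qed
  have \<gamma>_AE: "AE x in lborel. (\<gamma> (n - 1) has_real_derivative \<gamma> n x) (at x)" if "n \<ge> 1"
    using domAE by eventually_elim (use \<gamma>_hd[of _ "n - 1"] that in auto)
  \<comment> \<open>This is where the absolute continuity in \<open>Cb\<close> enters.\<close>
  have \<gamma>_lip: "locally_lipschitz (\<gamma> (n - 1))" if n: "n \<ge> 1"
  proof -
    have "AE x in lborel. \<exists>E. ((deriv ^^ (n - 1)) h has_real_derivative E) (at x) \<and> \<bar>E\<bar> \<le> D n"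
      using domAE
    proof eventually_elim
      case (elim x)
      then have "((deriv ^^ (n - 1)) h has_real_derivative (deriv ^^ n) h x) (at x)"
        using deriv_dom_Suc_has_real_derivative[of x "n - 1" h] n by (simp del: funpow.simps)
      moreover have "\<bar>(deriv ^^ n) h x\<bar> \<le> D n" using \<gamma>D[of n x] elim n by (simp add: \<gamma>)
      ultimately show ?case by blast
    qed
    then have "locally_lipschitz ((deriv ^^ (n - 1)) h)"
      using \<open>Cb n h\<close> n D0[of n]
      by (intro abs_cont_on_bounded_deriv_imp_locally_lipschitz[of _ "D n"]) (auto simp: Cb_def)
    then have "locally_lipschitz (\<lambda>x. (deriv ^^ (n - 1)) h x + - (if n - 1 = 0 then E else 0))"
      by (intro locally_lipschitz_add locally_lipschitz_const)
    moreover have "\<gamma> (n - 1) = (\<lambda>x. (deriv ^^ (n - 1)) h x + - (if n - 1 = 0 then E else 0))"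
      by (rule ext) (simp add: \<gamma>)
    ultimately show ?thesis by simp
  qed

  have htm: "htilde \<in> borel_measurable borel" unfolding ht using assms(6) by measurable
  have int: "integrable lborel (\<lambda>x. ?u x * htilde x)"
    by (rule student_t_integrable[OF M d \<delta> Z htm bht])
  have mean: "(LINT x|lborel. ?u x * htilde x) = 0"
    using student_t_centred[OF M d \<delta> Z assms(6) bh] by (simp add: ht E_def)
  have kB: "\<bar>?u x * htilde x\<bar> \<le> (\<delta>\<^sup>2) powr (- (d + 1) / 2) * (H + \<bar>E\<bar>)" for x
    unfolding abs_mult using weight_powr_bounded[OF \<delta>, of "- (d + 1) / 2" x] d Ht[of x]
    by (intro mult_mono) auto
  have P_lip: "locally_lipschitz P" unfolding P_def by (rule primitive_locally_lipschitz[OF int kB])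
  have P_bot: "(P \<longlongrightarrow> 0) at_bot" unfolding P_def by (rule primitive_at_bot[OF int kB])
  \<comment> \<open>Centring makes the full integral vanish, which is the boundary condition at plus
    infinity.\<close>
  have P_top: "(P \<longlongrightarrow> 0) at_top" using primitive_at_top[OF int kB] unfolding P_def mean .
  have P_AE: "AE x in lborel. (P has_real_derivative ?u x * htilde x) (at x)"
    unfolding P_def by (rule primitive_AE_deriv[OF int kB])
  \<comment> \<open>For \<open>n \<ge> 1\<close> the test function is continuous, so the fundamental
    theorem of calculus holds at every point and not just almost everywhere.\<close>
  have P_all: "(P has_real_derivative ?u x * htilde x) (at x)" if n: "n \<ge> 1" for x
  proof -
    have "continuous_on UNIV htilde"
    proof (cases "n = 1")
      case True
      then show ?thesis using locally_lipschitz_continuous[OF \<gamma>_lip] \<gamma>0 by simp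
    next
      case False
      then have "x \<in> deriv_dom (Suc 0) h" for x using dom[of "Suc 0"] n by auto
      then have "(htilde has_real_derivative \<gamma> (Suc 0) x) (at x)" for x
        using \<gamma>_hd[of x 0] unfolding \<gamma>0 by blast
      then show ?thesis by (meson DERIV_continuous continuous_at_imp_continuous_on)
    qed
    then show ?thesis unfolding P_def
      by (intro primitive_deriv[OF int kB] continuous_on_mult weight_powr_continuous[OF \<delta>])
  qed
  have f: "f = (\<lambda>x. (\<delta>\<^sup>2 + x\<^sup>2) powr ((d - 1) / 2) * P x)"
    by (simp add: assms(9) stein_solution_def P_def fun_eq_iff)
  have f_AE: "AE x in lborel. \<exists>E. (f has_real_derivative E) (at x) \<and> (\<delta>\<^sup>2 + x\<^sup>2) * E = (d - 1) * x * f x + \<gamma> 0 x"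
    using P_AE unfolding P_def \<gamma>0 assms(9) by eventually_elim (rule stein_solution_deriv[OF \<delta>])
  have f_all: "\<exists>E. (f has_real_derivative E) (at x) \<and> (\<delta>\<^sup>2 + x\<^sup>2) * E = (d - 1) * x * f x + \<gamma> 0 x" if "n \<ge> 1" for x
    using P_all[OF that, of x] unfolding P_def \<gamma>0 assms(9) by (rule stein_solution_deriv[OF \<delta>])
  \<comment> \<open>For \<open>f\<close> itself the rescaled function of the comparison argument is
    the primitive \<open>P\<close>, so both limits are already known.\<close>
  have "(\<delta>\<^sup>2 + x\<^sup>2) powr (- (d - 1) / 2) * f x = P x" for x
    using weight_powr_split(2)[OF \<delta>, of x d] unfolding f by (metis mult.assoc mult.commute mult_1)
  then have f_lim: "((\<lambda>x. (\<delta>\<^sup>2 + x\<^sup>2) powr (- (d - 1) / 2) * f x) \<longlongrightarrow> 0) at_bot"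
    "((\<lambda>x. (\<delta>\<^sup>2 + x\<^sup>2) powr (- (d - 1) / 2) * f x) \<longlongrightarrow> 0) at_top"
    using P_bot P_top by simp_all
  have f_lip: "locally_lipschitz f"
  proof -
    have "((\<lambda>x. (\<delta>\<^sup>2 + x\<^sup>2) powr ((d - 1) / 2)) has_real_derivative
        - ((2 - d) - 1) * x * (\<delta>\<^sup>2 + x\<^sup>2) powr (- ((2 - d) + 1) / 2)) (at x)" for x
      using weight_powr_deriv[OF \<delta>, of "2 - d" x] by simp
    then have "locally_lipschitz (\<lambda>x. (\<delta>\<^sup>2 + x\<^sup>2) powr ((d - 1) / 2))"
      by (rule locally_lipschitz_C1)
         (intro continuous_on_mult continuous_on_const continuous_on_id weight_powr_continuous[OF \<delta>])
    then show ?thesis unfolding f by (intro locally_lipschitz_mult P_lip)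
  qed
  \<comment> \<open>Starting from the Student law, \<open>d\<close> is lowered by 2 at a time;
    \<open>d - 2 * n > 0\<close> keeps the parameter above 2 before each step.\<close>
  have tail: "\<exists>W. stein_weight_tail \<delta> (d - 2 * real k) W" if "k \<le> n" for k
    using that
  proof (induction k)
    case 0
    show ?case using stein_weight_tail_student_t[OF M d \<delta> Z] by auto
  next
    case (Suc k)
    then obtain W where W: "stein_weight_tail \<delta> (d - 2 * real k) W" by auto
    have "d - 2 * real k > 2" using Suc.prems assms(5) by linarith
    moreover have "d - 2 * real (Suc k) = d - 2 * real k - 2" by simp
    ultimately show ?case using stein_weight_tail_step[OF W \<delta>] by metis
  qed
  have \<gamma>_deriv: "(\<gamma> k has_real_derivative \<gamma> (Suc k) x) (at x)" if "Suc k < n" for k x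
    using \<gamma>_hd dom[OF that] by blast
  \<comment> \<open>Collected in the order of the assumptions of the context above.\<close>
  note data = \<delta> assms(5) tail \<gamma>_deriv \<gamma>_lip \<gamma>_AE D0 Dk \<gamma>_AE_bound f_lip f_AE f_all f_lim
  have dk: "((deriv ^^ k) f has_real_derivative (deriv ^^ Suc k) f x) (at x)" if "k < n" for k x
    using stein_derivatives[where \<gamma> = \<gamma> and D = D and f = f and n = n and d = d and \<delta> = \<delta>, OF data that] by blast
  have bound: "\<bar>(deriv ^^ n) f x\<bar> \<le> stein_derivative_bound d \<delta> D n" for x
    using stein_derivative_bounds[where \<gamma> = \<gamma> and D = D and f = f and n = n and d = d and \<delta> = \<delta>, OF data order.refl] by blast
  have solves: "solves_stein_at d \<delta> htilde f x"
    if "\<exists>E. (f has_real_derivative E) (at x) \<and> (\<delta>\<^sup>2 + x\<^sup>2) * E = (d - 1) * x * f x + \<gamma> 0 x" for x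
  proof -
    from that obtain E where E: "(f has_real_derivative E) (at x)" "(\<delta>\<^sup>2 + x\<^sup>2) * E = (d - 1) * x * f x + htilde x"
      unfolding \<gamma>0 by blast
    have "(\<delta>\<^sup>2 + x\<^sup>2) * deriv f x - (d - 1) * x * f x = htilde x"
      unfolding DERIV_imp_deriv[OF E(1)] using E(2) by linarith
    then show ?thesis using E(1) unfolding solves_stein_at_def by (auto simp: real_differentiable_def)
  qed
  have domf: "deriv_dom n f = UNIV"
    using dk by (intro deriv_dom_eq_UNIV) (auto simp: real_differentiable_def simp del: funpow.simps)
  have "deriv_norm n f \<le> stein_derivative_bound d \<delta> D n"
    unfolding deriv_norm_def domf by (rule cSUP_least) (auto intro: bound)
  moreover have "AE x in lborel. solves_stein_at d \<delta> htilde f x"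
    using f_AE by eventually_elim (rule solves)
  moreover have "\<forall>x. solves_stein_at d \<delta> htilde f x" if "n \<ge> 1" using f_all[OF that] solves by blast
  moreover have "bounded (range ((deriv ^^ n) f))" using bound by (auto simp: bounded_iff)
  ultimately show ?thesis using domf unfolding stein_derivative_bound_def D_def by blast
qed

end
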